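(* Let $U_z=\{z:|z|<1\}$, $U_w=\{w:|w|<1\}$ and $0<t<1$. Let $f$ be a function of the class $\mathcal B$ such that the linear Lebesgue measure of the intersection of the image $f(U_z)$ with the imaginary axis is at most $2t$. Then $$\operatorname{Re}\frac{S_f(1)}{(f'(1))^2}\ \le\ -\frac32\left(\frac{1-t^2}{1+t^2}\right)^2 .$$ Equality holds, for instance, for the function $w=\tilde f_t(z)$ given by the equation $$\frac{2t}{1+t^2}\,\frac{z}{1-z^2}=\frac{w}{1-w^2},$$ which maps the unit disk $U_z$ conformally and univalently onto the disk $U_w$ with the segments $[it,i]$ and $[-it,-i]$ removed.
   Context: The class $\mathcal B$ consists of the functions $f$ holomorphic in the unit disk $U_z$ with $f(U_z)\subset U_w$ that have the asymptotic expansion $$f(z)=1+a_1(z-1)+a_2(z-1)^2+a_3(z-1)^3+\angle o((z-1)^3),$$ where $a_1>0$, $\operatorname{Re}(2a_2+a_1(1-a_1))=0$, and $\angle o((z-1)^3)$ denotes a quantity that is $o((z-1)^3)$ as $z\to1$ in every Stolz angle in $U_z$ with vertex at $z=1$. For such $f$ one sets $f'(1)=a_1$ and the boundary Schwarzian derivative at $1$ is $S_f(1)=6\bigl(a_3/a_1-a_2^2/a_1^2\bigr)$. *)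

theory Defs
  imports "HOL-Complex_Analysis.Complex_Analysis" "HOL-Library.Landau_Symbols"
begin

text \<open>
  The part inside the unit disk of the sector with vertex \<open>1\<close>, symmetric about the radius
  \<open>[0, 1]\<close>, of opening \<open>2 \<alpha>\<close>. No bound on the distance to the vertex is imposed, because the
  sets are only used for limits at \<open>1\<close>. Every sector at \<open>1\<close> with bounding rays
  pointing strictly into the disk lies in a symmetric one.
\<close>

definition stolz_angle :: "real \<Rightarrow> complex set" where
  "stolz_angle \<alpha> = {z \<in> ball 0 1. \<bar>Arg (1 - z)\<bar> < \<alpha>}"

definition boundary_expansion ::
    "(complex \<Rightarrow> complex) \<Rightarrow> complex \<Rightarrow> complex \<Rightarrow> complex \<Rightarrow> bool" where
  "boundary_expansion f a1 a2 a3 \<longleftrightarrow>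
     (\<forall>\<alpha>. 0 < \<alpha> \<and> \<alpha> < pi / 2 \<longrightarrow>
       (\<lambda>z. f z - (1 + a1 * (z - 1) + a2 * (z - 1) ^ 2 + a3 * (z - 1) ^ 3))
         \<in> o[at 1 within stolz_angle \<alpha>](\<lambda>z. (z - 1) ^ 3))"

definition class_B :: "(complex \<Rightarrow> complex) set" where
  "class_B = {f. f holomorphic_on ball 0 1 \<and> f ` ball 0 1 \<subseteq> ball 0 1 \<and>
     (\<exists>(a1::real) (a2::complex) (a3::complex).
        a1 > 0 \<and> Re (2 * a2 + of_real a1 * (1 - of_real a1)) = 0 \<and>
        boundary_expansion f (of_real a1) a2 a3)}"

text \<open>
  The coefficients of a boundary expansion are determined by the function
  (\<open>boundary_expansion_unique\<close> below), so the definite description is meaningful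
  for every member of \<open>class_B\<close>.
\<close>

definition boundary_coeffs :: "(complex \<Rightarrow> complex) \<Rightarrow> complex \<times> complex \<times> complex" where
  "boundary_coeffs f = (THE (a1, a2, a3). boundary_expansion f a1 a2 a3)"

definition boundary_deriv :: "(complex \<Rightarrow> complex) \<Rightarrow> complex" where
  "boundary_deriv f = (case boundary_coeffs f of (a1, a2, a3) \<Rightarrow> a1)"

definition boundary_schwarzian :: "(complex \<Rightarrow> complex) \<Rightarrow> complex" where
  "boundary_schwarzian f =
     (case boundary_coeffs f of (a1, a2, a3) \<Rightarrow> 6 * (a3 / a1 - a2\<^sup>2 / a1\<^sup>2))"

text \<open>Linear Lebesgue measure on the imaginary axis, parametrised isometrically by \<open>y \<mapsto> \<i> y\<close>.\<close>

definition imag_axis_measure :: "complex set \<Rightarrow> ennreal" where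
  "imag_axis_measure A = emeasure lebesgue {y::real. \<i> * of_real y \<in> A}"

definition slit_equation :: "real \<Rightarrow> complex \<Rightarrow> complex \<Rightarrow> bool" where
  "slit_equation t z w \<longleftrightarrow>
     of_real (2 * t / (1 + t\<^sup>2)) * (z / (1 - z\<^sup>2)) = w / (1 - w\<^sup>2)"

definition slit_map :: "real \<Rightarrow> complex \<Rightarrow> complex" where
  "slit_map t z = (THE w. w \<in> ball 0 1 \<and> slit_equation t z w)"

lemma boundary_expansion_unique:
  assumes "boundary_expansion f a1 a2 a3" "boundary_expansion f b1 b2 b3"
  shows "a1 = b1 \<and> a2 = b2 \<and> a3 = b3"
proof -
  let ?S = "stolz_angle (pi / 4)"
  let ?F = "at (1::complex) within ?S"
  define c1 c2 c3 where c: "c1 = b1 - a1" "c2 = b2 - a2" "c3 = b3 - a3"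
  have "(\<lambda>z. (f z - (1 + a1 * (z - 1) + a2 * (z - 1) ^ 2 + a3 * (z - 1) ^ 3))
           - (f z - (1 + b1 * (z - 1) + b2 * (z - 1) ^ 2 + b3 * (z - 1) ^ 3)))
         \<in> o[?F](\<lambda>z. (z - 1) ^ 3)"
  proof (rule sum_in_smallo(2))
    have "0 < pi / 4" "pi / 4 < pi / 2" by simp_all
    thus "(\<lambda>z. f z - (1 + a1 * (z - 1) + a2 * (z - 1) ^ 2 + a3 * (z - 1) ^ 3)) \<in> o[?F](\<lambda>z. (z - 1) ^ 3)"
      and "(\<lambda>z. f z - (1 + b1 * (z - 1) + b2 * (z - 1) ^ 2 + b3 * (z - 1) ^ 3)) \<in> o[?F](\<lambda>z. (z - 1) ^ 3)"
      using assms unfolding boundary_expansion_def by blast+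
  qed
  also have "(\<lambda>z. (f z - (1 + a1 * (z - 1) + a2 * (z - 1) ^ 2 + a3 * (z - 1) ^ 3))
           - (f z - (1 + b1 * (z - 1) + b2 * (z - 1) ^ 2 + b3 * (z - 1) ^ 3)))
         = (\<lambda>z. c1 * (z - 1) + c2 * (z - 1) ^ 2 + c3 * (z - 1) ^ 3)"
    by (rule ext) (simp add: c algebra_simps)
  finally have o: "(\<lambda>z. c1 * (z - 1) + c2 * (z - 1) ^ 2 + c3 * (z - 1) ^ 3)
         \<in> o[?F](\<lambda>z. (z - 1) ^ 3)" .
  have path: "filterlim (\<lambda>x. 1 - complex_of_real x) ?F (at_right 0)"
    unfolding filterlim_at
  proof
    have "eventually (\<lambda>x::real. x \<in> {0<..<1}) (at_right 0)"
      by (rule eventually_at_right_real) simp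
    thus "eventually (\<lambda>x. 1 - complex_of_real x \<in> ?S \<and> 1 - complex_of_real x \<noteq> 1) (at_right 0)"
    proof eventually_elim
      case (elim x)
      have "norm (1 - complex_of_real x) = \<bar>1 - x\<bar>"
        by (metis norm_of_real of_real_1 of_real_diff)
      thus ?case using elim by (auto simp: stolz_angle_def)
    qed
    have "((\<lambda>x. 1 - complex_of_real x) \<longlongrightarrow> 1 - of_real 0) (at_right 0)"
      by (intro tendsto_intros)
    thus "((\<lambda>x. 1 - complex_of_real x) \<longlongrightarrow> 1) (at_right 0)" by simp
  qed
  have "((\<lambda>z. (c1 * (z - 1) + c2 * (z - 1) ^ 2 + c3 * (z - 1) ^ 3) / (z - 1) ^ 3) \<longlongrightarrow> 0) ?F"
    using smalloD_tendsto[OF o] .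
  from filterlim_compose[OF this path]
  have L: "((\<lambda>x. (c1 * (- of_real x) + c2 * (- of_real x) ^ 2 + c3 * (- of_real x) ^ 3)
              / (- of_real x) ^ 3) \<longlongrightarrow> 0) (at_right (0::real))"
    by simp
  have pos: "eventually (\<lambda>x::real. x > 0) (at_right 0)"
    by (simp add: eventually_at_right_less)
  have nt: "at_right (0::real) \<noteq> bot" by simp
  have "((\<lambda>x::real. - complex_of_real x) \<longlongrightarrow> - of_real 0) (at_right 0)"
    by (intro tendsto_intros)
  hence u: "((\<lambda>x::real. - complex_of_real x) \<longlongrightarrow> 0) (at_right 0)" by simp
  define u :: "real \<Rightarrow> complex" where "u = (\<lambda>x. - of_real x)"
  define q where "q = (\<lambda>x. (c1 * u x + c2 * u x ^ 2 + c3 * u x ^ 3) / u x ^ 3)"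
  have ulim: "(u \<longlongrightarrow> 0) (at_right 0)" using u by (simp only: u_def)
  have qlim: "(q \<longlongrightarrow> 0) (at_right 0)" using L by (simp only: q_def u_def)
  have u0: "eventually (\<lambda>x. u x \<noteq> 0) (at_right 0)"
    using pos by eventually_elim (simp add: u_def)
  have q: "q x * u x ^ 3 = c1 * u x + c2 * u x ^ 2 + c3 * u x ^ 3" if "u x \<noteq> 0" for x
    using that by (simp add: q_def)
  have const: "c = 0" if "eventually (\<lambda>x. g x = c) (at_right 0)" "(g \<longlongrightarrow> 0) (at_right 0)"
    for g :: "real \<Rightarrow> complex" and c
    using tendsto_unique[OF nt that(2) tendsto_eventually[OF that(1)]] by simp
  have "((\<lambda>x. q x * u x ^ 2 - (c2 * u x + c3 * u x ^ 2)) \<longlongrightarrow> 0 * 0 ^ 2 - (c2 * 0 + c3 * 0 ^ 2)) (at_right 0)"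
    by (intro tendsto_intros qlim ulim)
  hence l1: "((\<lambda>x. q x * u x ^ 2 - (c2 * u x + c3 * u x ^ 2)) \<longlongrightarrow> 0) (at_right 0)" by simp
  have "eventually (\<lambda>x. q x * u x ^ 2 - (c2 * u x + c3 * u x ^ 2) = c1) (at_right 0)"
    using u0
  proof eventually_elim
    case (elim x)
    have "u x * (q x * u x ^ 2 - (c2 * u x + c3 * u x ^ 2)) = u x * c1"
      using q[OF elim] by (simp add: algebra_simps power2_eq_square power3_eq_cube)
    thus ?case using elim by (simp only: mult_left_cancel[OF elim])
  qed
  from const[OF this l1] have c1: "c1 = 0" .
  have "((\<lambda>x. q x * u x - c3 * u x) \<longlongrightarrow> 0 * 0 - c3 * 0) (at_right 0)"
    by (intro tendsto_intros qlim ulim)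
  hence l2: "((\<lambda>x. q x * u x - c3 * u x) \<longlongrightarrow> 0) (at_right 0)" by simp
  have "eventually (\<lambda>x. q x * u x - c3 * u x = c2) (at_right 0)"
    using u0
  proof eventually_elim
    case (elim x)
    have "u x ^ 2 * (q x * u x - c3 * u x) = u x ^ 2 * c2"
      using q[OF elim] by (simp add: c1 algebra_simps power2_eq_square power3_eq_cube)
    thus ?case using elim by simp
  qed
  from const[OF this l2] have c2: "c2 = 0" .
  have "eventually (\<lambda>x. q x = c3) (at_right 0)"
    using u0 by eventually_elim (simp add: q_def c1 c2)
  from const[OF this qlim] have c3: "c3 = 0" .
  show ?thesis using c1 c2 c3 c by simp
qed

lemma boundary_coeffs_eq:
  assumes "boundary_expansion f a1 a2 a3"
  shows "boundary_coeffs f = (a1, a2, a3)"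
  unfolding boundary_coeffs_def
proof (rule the_equality)
  show "case (a1, a2, a3) of (a1, a2, a3) \<Rightarrow> boundary_expansion f a1 a2 a3"
    using assms by simp
next
  fix p assume p: "case p of (a1, a2, a3) \<Rightarrow> boundary_expansion f a1 a2 a3"
  obtain b1 b2 b3 where b: "p = (b1, b2, b3)" by (metis prod_cases3)
  with p have "boundary_expansion f b1 b2 b3" by simp
  from boundary_expansion_unique[OF this assms] b show "p = (a1, a2, a3)" by simp
qed

end

theory Submission
  imports Defs
begin

text \<open>
  Put \<open>K = 4 f / (1 - f\<^sup>2)\<close>. The map \<open>w \<mapsto> 4 w / (1 - w\<^sup>2)\<close> sends the disk onto the plane slit along
  \<open>{i y : \<bar>y\<bar> \<ge> 2}\<close> and the imaginary diameter onto the gap between the two slits; since its derivative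
  there decreases away from \<open>0\<close>, the image of \<open>K\<close> meets the imaginary axis in a set \<open>i U\<close> with
  \<open>\<bar>U\<bar> \<le> 2 l\<close>, \<open>l = 4 t / (1 + t\<^sup>2)\<close>. For a single gap \<open>(-l, l)\<close> the function
  \<open>Re (J + sqrt (J\<^sup>2 + l\<^sup>2)) / 2\<close> is positive harmonic and is the sum of the positive part of \<open>Re J\<close> and a
  Poisson integral of a semicircle density. Transporting this density to \<open>U\<close> by the map that collapses
  the complement of \<open>U\<close> gives a positive function \<open>u\<close> which is locally dominated by translates of the
  one-gap function, hence superharmonic off the slits. Comparing \<open>u \<circ> K\<close> with the Poisson kernel at
  \<open>1\<close> by Julia's lemma and the minimum principle, and expanding along the radius, bounds the Schwarzian.
\<close>

section \<open>The lemmas of Schwarz--Pick and Julia\<close>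

text \<open>\<open>U\<close> may have infinitely many components, and the plane slit outside the
  gaps has no explicit conformal map; \<open>gap_potential\<close> stands in for the real part of
  one. Its expansion at infinity sees \<open>U\<close> only through the length: the transported
  density keeps the mass l^2 / 4 of the semicircle density, so in the right half-plane the potential
  is Re J + Re (l^2 / (4 J)) up to o(1 / |J|). The price is superharmonicity instead of harmonicity,
  and that is the side on which a minimum principle works. For \<open>slit_map t\<close> the
  comparison is an equality. Let c = 2 t / (1 + t^2) and C = (1 + z) / (1 - z). Then K = c (C - 1 /
  C), the one gap is (-2 c, 2 c), and (K + sqrt (K^2 + 4 c^2)) / 2 = c C. Hence l = 2 c, and the
  factor 1 / a of the Poisson kernel, where a = 1 / c. At 1 both sides of the comparison are
  unbounded: Julia's lemma bounds their difference from below, and a small multiple of - log |1 - z|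
  absorbs the bound. Along the radius z = 1 - h the real parts of order 1 / h and 1 then agree by
  the normalization of a_2, and the terms of order h give the estimate.\<close>

lemma norm_one_minus_cnj_mult:
  "(norm (1 - cnj w * z))\<^sup>2 - (norm (z - w))\<^sup>2 = (1 - (norm z)\<^sup>2) * (1 - (norm w)\<^sup>2)"
  unfolding cmod_power2 by (simp add: power2_eq_square algebra_simps)

text \<open>Multiplied out because in Julia's lemma \<open>w\<close> tends to the boundary, where
  both sides vanish to first order. The proof moves \<open>w\<close> and \<open>f w\<close> to the
  origin by disk automorphisms and applies the Schwarz lemma.\<close>

lemma Schwarz_Pick:
  assumes holf: "f holomorphic_on ball 0 1" and f: "f ` ball 0 1 \<subseteq> ball 0 1"
    and z: "z \<in> ball 0 1" and w: "w \<in> ball 0 1"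
  shows "(1 - (norm z)\<^sup>2) * (1 - (norm w)\<^sup>2) * (norm (1 - cnj (f w) * f z))\<^sup>2
       \<le> (1 - (norm (f z))\<^sup>2) * (1 - (norm (f w))\<^sup>2) * (norm (1 - cnj w * z))\<^sup>2"
proof -
  define M where "M = Moebius_function 0"
  define h where "h = (\<lambda>x. M (f w) (f (M (-w) x)))"
  have fb: "norm (f x) < 1" if "norm x < 1" for x
    using f that by (simp add: image_subset_iff)
  have nw: "norm w < 1" "norm z < 1" "norm (- w) < 1" using w z by auto
  have holM: "M a holomorphic_on ball 0 1" if "norm a < 1" for a
    unfolding M_def by (rule Moebius_function_holomorphic[OF that])
  have Mb: "norm (M a x) < 1" if "norm a < 1" "norm x < 1" for a x
    unfolding M_def using Moebius_function_norm_lt_1 that by blast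
  have holh: "h holomorphic_on ball 0 1"
    unfolding h_def
    using holomorphic_on_compose_gen[OF holomorphic_on_compose_gen[OF holM[OF nw(3)] holf] holM[OF fb[OF nw(1)]]]
      Mb[OF nw(3)] fb by (auto simp: o_def image_subset_iff)
  have "norm (h x) < 1" if "norm x < 1" for x
    unfolding h_def using that nw by (intro Mb fb)
  moreover have "h 0 = 0"
    by (simp add: h_def M_def Moebius_function_def)
  moreover have nM: "norm (M w z) < 1" by (rule Mb[OF nw(1,2)])
  ultimately have le: "norm (h (M w z)) \<le> norm (M w z)"
    using Schwarz_Lemma(1)[OF holh] by blast
  have "M (-w) (M w z) = z"
    unfolding M_def using Moebius_function_compose[of "-w" w z] nw by auto
  hence "norm (M (f w) (f z)) \<le> norm (M w z)" using le by (simp add: h_def)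
  hence "norm ((f z - f w) / (1 - cnj (f w) * f z)) \<le> norm ((z - w) / (1 - cnj w * z))"
    by (simp add: M_def Moebius_function_def)
  moreover have ne: "1 - cnj b * a \<noteq> 0" if "norm a < 1" "norm b < 1" for a b :: complex
  proof
    assume "1 - cnj b * a = 0"
    hence "norm (cnj b * a) = 1" by (metis eq_iff_diff_eq_0 norm_one)
    thus False using mult_strict_mono[of "norm b" 1 "norm a" 1] that by (simp add: norm_mult)
  qed
  ultimately have "norm (f z - f w) * norm (1 - cnj w * z) \<le> norm (z - w) * norm (1 - cnj (f w) * f z)"
    using ne[OF nw(2,1)] ne[OF fb[OF nw(2)] fb[OF nw(1)]] by (simp add: norm_divide divide_simps mult_ac split: if_splits)
  hence "(norm (f z - f w) * norm (1 - cnj w * z))\<^sup>2 \<le> (norm (z - w) * norm (1 - cnj (f w) * f z))\<^sup>2"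
    by (intro power_mono) auto
  hence "(norm (f z - f w))\<^sup>2 * (norm (1 - cnj w * z))\<^sup>2 \<le> (norm (z - w))\<^sup>2 * (norm (1 - cnj (f w) * f z))\<^sup>2"
    by (simp add: power_mult_distrib)
  thus ?thesis
    unfolding norm_one_minus_cnj_mult[symmetric] by (simp add: algebra_simps)
qed

lemma Re_cayley: "z \<noteq> 1 \<Longrightarrow> Re ((1 + z) / (1 - z)) = (1 - (norm z)\<^sup>2) / (norm (1 - z))\<^sup>2"
  unfolding Re_divide cmod_power2 by (simp add: power2_eq_square algebra_simps)

text \<open>Schwarz-Pick for the pair z and 1 - h, divided by h, in the limit h -> 0. The difference
  quotient makes 1 - |f (1 - h)|^2 behave like 2 a h, against 2 h for 1 - |1 - h|^2; the ratio is
  the factor 1 / a.\<close>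

lemma Julia:
  assumes holf: "f holomorphic_on ball 0 1" and f: "f ` ball 0 1 \<subseteq> ball 0 1"
    and lim: "((\<lambda>h. (1 - f (1 - of_real h)) / of_real h) \<longlongrightarrow> of_real a) (at_right 0)"
    and a: "a > 0" and z: "z \<in> ball 0 1"
  shows "Re ((1 + f z) / (1 - f z)) \<ge> Re ((1 + z) / (1 - z)) / a"
proof -
  let ?F = "at_right (0::real)"
  define q where "q = (\<lambda>h::real. (1 - f (1 - of_real h)) / complex_of_real h)"
  have q: "(q \<longlongrightarrow> of_real a) ?F" using lim by (simp add: q_def)
  have h: "((\<lambda>h. complex_of_real h) \<longlongrightarrow> of_real 0) ?F" by (intro tendsto_intros)
  have ev: "eventually (\<lambda>h::real. h \<in> {0<..<1}) ?F"
    by (rule eventually_at_right_real) simp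
  have "eventually (\<lambda>h. 1 - of_real h * q h = f (1 - of_real h)) ?F"
    using ev by eventually_elim (simp add: q_def)
  moreover have "((\<lambda>h. 1 - of_real h * q h) \<longlongrightarrow> 1 - of_real 0 * of_real a) ?F"
    by (intro tendsto_intros q h)
  ultimately have f1: "((\<lambda>h. f (1 - of_real h)) \<longlongrightarrow> 1) ?F"
    by (simp add: filterlim_cong)
  have le: "eventually (\<lambda>h. (1 - (norm z)\<^sup>2) * (2 - h) * (norm (1 - cnj (f (1 - of_real h)) * f z))\<^sup>2
       \<le> (1 - (norm (f z))\<^sup>2) * (2 * Re (q h) - h * (norm (q h))\<^sup>2) * (norm (1 - cnj (1 - of_real h) * z))\<^sup>2) ?F"
    using ev
  proof eventually_elim
    case (elim h)
    have "norm (1 - complex_of_real h) = \<bar>1 - h\<bar>"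
      by (metis norm_of_real of_real_1 of_real_diff)
    hence n: "norm (1 - complex_of_real h) = 1 - h" using elim by simp
    have fe: "f (1 - of_real h) = 1 - of_real h * q h" using elim by (simp add: q_def)
    have n2: "1 - (norm (f (1 - of_real h)))\<^sup>2 = h * (2 * Re (q h) - h * (norm (q h))\<^sup>2)"
      unfolding fe cmod_power2 by (simp add: power2_eq_square algebra_simps)
    have n3: "1 - (norm (1 - complex_of_real h))\<^sup>2 = h * (2 - h)"
      unfolding n by (simp add: power2_eq_square algebra_simps)
    have "(1 - (norm z)\<^sup>2) * (h * (2 - h)) * (norm (1 - cnj (f (1 - of_real h)) * f z))\<^sup>2
       \<le> (1 - (norm (f z))\<^sup>2) * (h * (2 * Re (q h) - h * (norm (q h))\<^sup>2)) * (norm (1 - cnj (1 - of_real h) * z))\<^sup>2"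
      using Schwarz_Pick[OF holf f z, of "1 - of_real h"] n elim unfolding n2 n3 by simp
    hence "h * ((1 - (norm z)\<^sup>2) * (2 - h) * (norm (1 - cnj (f (1 - of_real h)) * f z))\<^sup>2)
       \<le> h * ((1 - (norm (f z))\<^sup>2) * (2 * Re (q h) - h * (norm (q h))\<^sup>2) * (norm (1 - cnj (1 - of_real h) * z))\<^sup>2)"
      by (simp only: mult_ac)
    thus ?case using elim by (simp add: mult_le_cancel_left_pos del: complex_cnj_diff)
  qed
  have "(1 - (norm z)\<^sup>2) * (2 - 0) * (norm (1 - cnj 1 * f z))\<^sup>2
      \<le> (1 - (norm (f z))\<^sup>2) * (2 * Re (of_real a) - 0 * (norm (complex_of_real a))\<^sup>2) * (norm (1 - cnj (1 - of_real 0) * z))\<^sup>2"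
    by (rule tendsto_le[OF _ _ _ le]) (intro tendsto_intros q h f1 | simp)+
  hence main: "(1 - (norm z)\<^sup>2) * (norm (1 - f z))\<^sup>2 \<le> a * (1 - (norm (f z))\<^sup>2) * (norm (1 - z))\<^sup>2"
    by (simp add: algebra_simps)
  have ne: "z \<noteq> 1" "f z \<noteq> 1" using z f by force+
  have "(1 - (norm z)\<^sup>2) / (norm (1 - z))\<^sup>2 / a \<le> (1 - (norm (f z))\<^sup>2) / (norm (1 - f z))\<^sup>2"
    using main ne a by (simp add: divide_simps mult_ac)
  thus ?thesis using ne by (simp add: Re_cayley)
qed

section \<open>The map onto the twofold slit plane\<close>

text \<open>With C = (1 + w) / (1 - w) this is C - 1 / C. It is four times the function in
  \<open>slit_equation\<close>, which therefore only rescales it; the factor 4 puts the tips of the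
  slits at 2 i and - 2 i.\<close>

definition twofold_slit_map :: "complex \<Rightarrow> complex" where
  "twofold_slit_map w = 4 * w / (1 - w\<^sup>2)"

lemma square_neq_1: "norm w < 1 \<Longrightarrow> 1 - w\<^sup>2 \<noteq> (0 :: complex)"
proof
  assume w: "norm w < 1" and "1 - w\<^sup>2 = 0"
  hence "norm w ^ 2 = 1" by (simp flip: norm_power)
  thus False using w norm_ge_zero[of w] by (auto simp: power2_eq_1_iff)
qed

lemma Re_twofold_slit_map:
  "Re (twofold_slit_map w) = 4 * Re w * (1 - (norm w)\<^sup>2) / (norm (1 - w\<^sup>2))\<^sup>2"
  unfolding twofold_slit_map_def Re_divide cmod_power2
  by (simp add: power2_eq_square algebra_simps)

lemma twofold_slit_map_imaginary:
  "twofold_slit_map (\<i> * of_real y) = \<i> * of_real (4 * y / (1 + y\<^sup>2))"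
  by (simp add: twofold_slit_map_def power_mult_distrib)

lemma Re_twofold_slit_map_eq_0_iff:
  assumes "norm w < 1"
  shows "Re (twofold_slit_map w) = 0 \<longleftrightarrow> Re w = 0"
proof -
  have "(norm w)\<^sup>2 < 1" using assms by (simp add: power_less_one_iff)
  thus ?thesis using square_neq_1[OF assms] by (auto simp: Re_twofold_slit_map)
qed

lemma holomorphic_on_twofold_slit_map: "twofold_slit_map holomorphic_on ball 0 1"
  unfolding twofold_slit_map_def[abs_def] using square_neq_1 by (intro holomorphic_intros) auto

text \<open>For Re w > 0 the map is C - 1 / C with Re (1 / C) at most 1; for the other w already Re
  C is at most 1. Together with Julia's lemma this controls the comparison at the boundary point
  1.\<close>

lemma Re_cayley_le_twofold_slit_map:
  assumes w: "norm w < 1"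
  shows "Re ((1 + w) / (1 - w)) - 1 \<le> max 0 (Re (twofold_slit_map w))"
proof -
  have w1: "w \<noteq> 1" "1 + w \<noteq> 0" using w by (auto simp: add_eq_0_iff)
  have n: "(norm w)\<^sup>2 \<ge> 0" "(norm w)\<^sup>2 < 1" using w by (auto simp: power_less_one_iff)
  show ?thesis
  proof (cases "Re w > 0")
    case True
    have "twofold_slit_map w = (1 + w) / (1 - w) - (1 - w) / (1 + w)"
      using w1 square_neq_1[OF w] unfolding twofold_slit_map_def
      by (simp add: divide_simps power2_eq_square) (simp add: algebra_simps)
    moreover have "Re ((1 - w) / (1 + w)) \<le> 1"
    proof -
      have "Re ((1 - w) / (1 + w)) = (1 - (norm w)\<^sup>2) / (norm (1 + w))\<^sup>2"
      proof -
        have "- w \<noteq> 1" using w1(2) by (metis left_minus)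
        thus ?thesis using Re_cayley[of "- w"] by simp
      qed
      moreover have "1 \<le> norm (1 + w)" using abs_Re_le_cmod[of "1 + w"] True by simp
      hence "1 \<le> (norm (1 + w))\<^sup>2" by simp
      hence "(1 - (norm w)\<^sup>2) / (norm (1 + w))\<^sup>2 \<le> 1 / 1" using n by (intro frac_le) auto
      ultimately show ?thesis by simp
    qed
    ultimately show ?thesis by simp
  next
    case False
    have "1 \<le> norm (1 - w)" using abs_Re_le_cmod[of "1 - w"] False by simp
    hence "1 \<le> (norm (1 - w))\<^sup>2" by simp
    hence "(1 - (norm w)\<^sup>2) / (norm (1 - w))\<^sup>2 \<le> 1 / 1" using n by (intro frac_le) auto
    hence "Re ((1 + w) / (1 - w)) \<le> 1" using w1 by (simp add: Re_cayley)
    thus ?thesis by simp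
  qed
qed

section \<open>Boundary expansions along the radius to 1\<close>

lemma filterlim_radial_stolz:
  assumes "\<alpha> > 0"
  shows "filterlim (\<lambda>h. 1 - complex_of_real h) (at 1 within stolz_angle \<alpha>) (at_right 0)"
  unfolding filterlim_at
proof
  have "eventually (\<lambda>h::real. h \<in> {0<..<1}) (at_right 0)"
    by (rule eventually_at_right_real) simp
  thus "eventually (\<lambda>h. 1 - complex_of_real h \<in> stolz_angle \<alpha> \<and> 1 - complex_of_real h \<noteq> 1) (at_right 0)"
  proof eventually_elim
    case (elim h)
    have "norm (1 - complex_of_real h) = \<bar>1 - h\<bar>"
      by (metis norm_of_real of_real_1 of_real_diff)
    thus ?case using elim assms by (auto simp: stolz_angle_def)
  qed
  have "((\<lambda>h. 1 - complex_of_real h) \<longlongrightarrow> 1 - of_real 0) (at_right 0)" by (intro tendsto_intros)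
  thus "((\<lambda>h. 1 - complex_of_real h) \<longlongrightarrow> 1) (at_right 0)" by simp
qed

text \<open>Horner form in h = 1 - z, with the remainder absorbed into the last coefficient: later
  computations are exact identities, and the limit of \<open>r\<close> is all that is left of the
  asymptotics.\<close>

lemma boundary_expansion_radial:
  assumes "boundary_expansion f a1 a2 a3"
  obtains r where "(r \<longlongrightarrow> a3) (at_right 0)"
    "\<And>h. h \<noteq> 0 \<Longrightarrow> f (1 - of_real h) = 1 - of_real h * (a1 + of_real h * (- a2 + of_real h * r h))"
proof -
  define q where "q = (\<lambda>z. (f z - (1 + a1 * (z - 1) + a2 * (z - 1) ^ 2 + a3 * (z - 1) ^ 3)) / (z - 1) ^ 3)"
  have "(q \<longlongrightarrow> 0) (at 1 within stolz_angle (pi / 4))"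
    unfolding q_def using assms by (intro smalloD_tendsto) (simp add: boundary_expansion_def)
  from filterlim_compose[OF this filterlim_radial_stolz]
  have "((\<lambda>h. q (1 - of_real h)) \<longlongrightarrow> 0) (at_right 0)" by simp
  hence "((\<lambda>h. a3 + q (1 - of_real h)) \<longlongrightarrow> a3 + 0) (at_right 0)" by (intro tendsto_intros)
  moreover have "f (1 - of_real h) = 1 - of_real h * (a1 + of_real h * (- a2 + of_real h * (a3 + q (1 - of_real h))))"
    if "h \<noteq> 0" for h
  proof -
    have "(- complex_of_real h) ^ 3 \<noteq> 0" using that by simp
    hence "q (1 - of_real h) * (- of_real h) ^ 3 = f (1 - of_real h) - (1 + a1 * (- of_real h) + a2 * (- of_real h) ^ 2 + a3 * (- of_real h) ^ 3)"
      unfolding q_def by simp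
    thus ?thesis by (simp add: algebra_simps power2_eq_square power3_eq_cube)
  qed
  ultimately show ?thesis by (intro that[of "\<lambda>h. a3 + q (1 - of_real h)"]) auto
qed

section \<open>How the slit map stretches sets on the imaginary diameter\<close>

lemma emeasure_twofold_slit_image_le:
  fixes V W :: "real set"
  assumes t: "0 < t" "t < 1"
    and V: "V \<in> sets borel" "V \<subseteq> {-1<..<1}" "emeasure lborel V \<le> ennreal (2 * t)"
    and W: "W \<in> sets borel" "W = (\<lambda>y. 4 * y / (1 + y\<^sup>2)) ` V"
  shows "emeasure lborel W \<le> ennreal (8 * t / (1 + t\<^sup>2))"
proof -
  define p where "p = (\<lambda>y::real. 4 * y / (1 + y\<^sup>2))"
  define p' where "p' = (\<lambda>y::real. 4 * (1 - y\<^sup>2) / (1 + y\<^sup>2)\<^sup>2)"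
  have nz: "1 + y * y \<noteq> 0" "1 + y\<^sup>2 \<noteq> 0" for y :: real
    by (simp_all add: add_nonneg_eq_0_iff)
  have der: "(p has_real_derivative p' y) (at y)" for y
    unfolding p_def p'_def using nz[of y]
    by (auto intro!: derivative_eq_intros simp: power2_eq_square)
  have contp': "continuous_on A p'" for A
    unfolding p'_def using nz by (intro continuous_intros) auto
  have p'_nonneg: "p' y \<ge> 0" if "\<bar>y\<bar> \<le> 1" for y
    unfolding p'_def using that by (auto simp: abs_square_le_1)
  have p'_mono: "p' y \<le> p' x" if "\<bar>x\<bar> \<le> \<bar>y\<bar>" "\<bar>y\<bar> \<le> 1" for x y
  proof -
    have "x\<^sup>2 \<le> y\<^sup>2" using that by (simp add: abs_le_square_iff)
    moreover have "y\<^sup>2 \<le> 1" using that by (simp add: abs_square_le_1)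
    ultimately show ?thesis unfolding p'_def by (intro frac_le mult_left_mono power_mono) (auto simp: nz)
  qed
  \<comment> \<open>Equal values of \<open>p\<close> force (x - y) (1 - x y) = 0, and |x y| <
    1.\<close>
  have inj: "y \<in> V" if y: "y \<in> {-1..1}" "p y \<in> W" for y
  proof -
    obtain x where x: "x \<in> V" "p x = p y" using y(2) W(2) by (auto simp: p_def)
    have "4 * x * (1 + y\<^sup>2) = 4 * y * (1 + x\<^sup>2)" using x(2) nz(2)[of x] nz(2)[of y] by (simp add: p_def frac_eq_eq)
    hence "(x - y) * (1 - x * y) = 0" by (simp add: power2_eq_square algebra_simps)
    moreover have "\<bar>x\<bar> * \<bar>y\<bar> < 1"
    proof -
      have "\<bar>x\<bar> * \<bar>y\<bar> \<le> \<bar>x\<bar> * 1" using y(1) by (intro mult_left_mono) auto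
      moreover have "x \<in> {-1<..<1}" using V(2) x(1) by blast
      hence "\<bar>x\<bar> < 1" by (simp add: abs_less_iff)
      ultimately show ?thesis by simp
    qed
    hence "x * y \<noteq> 1" by (auto simp flip: abs_mult)
    ultimately show ?thesis using x(1) by auto
  qed
  have "emeasure lborel W = (\<integral>\<^sup>+x. ennreal (indicator W x * indicator {p (-1)..p 1} x) \<partial>lborel)"
  proof -
    have "W \<subseteq> {p (-1)..p 1}"
    proof
      fix x assume "x \<in> W"
      then obtain y where y: "y \<in> V" "x = p y" using W(2) by (auto simp: p_def)
      have "-2 * (1 + y\<^sup>2) \<le> 4 * y" "4 * y \<le> 2 * (1 + y\<^sup>2)"
        using zero_le_power2[of "1 + y"] zero_le_power2[of "1 - y"] by (simp_all add: power2_eq_square algebra_simps)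
      moreover have "1 + y\<^sup>2 > 0" by (simp add: add_pos_nonneg)
      ultimately show "x \<in> {p (-1)..p 1}" by (simp add: y p_def field_simps)
    qed
    hence eq: "indicator W x * indicator {p (-1)..p 1} x = indicat_real W x" for x
      by (auto simp: indicator_def)
    show ?thesis unfolding eq using W(1) by (simp add: ennreal_indicator)
  qed
  also have "\<dots> = (\<integral>\<^sup>+x. ennreal (indicator W (p x) * p' x * indicator {-1..1} x) \<partial>lborel)"
  proof (rule nn_integral_substitution)
    have "(\<lambda>x. indicat_real {p (-1)..p 1} x *\<^sub>R indicat_real W x) \<in> borel_measurable borel"
      using W(1) by measurable
    thus "set_borel_measurable borel {p (-1)..p 1} (indicat_real W)"
      by (simp only: set_borel_measurable_def)
    show "0 \<le> p' x" if "x \<in> {-1..1}" for x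
      using that by (intro p'_nonneg) (simp add: abs_le_iff)
  qed (use der contp' in simp_all)
  \<comment> \<open>Bathtub estimate: on \<open>V\<close> split p' into its excess over p' t, which
    is nonnegative exactly where |x| is at most t, and the constant p' t. For V = (-t, t) nothing is
    lost.\<close>
  also have "\<dots> \<le> (\<integral>\<^sup>+x. ennreal (p' x - p' t) * indicator {-t..t} x + ennreal (p' t) * indicator V x \<partial>lborel)"
  proof (intro nn_integral_mono)
    fix x :: real
    show "ennreal (indicator W (p x) * p' x * indicator {-1..1} x)
        \<le> ennreal (p' x - p' t) * indicator {-t..t} x + ennreal (p' t) * indicator V x"
    proof (cases "x \<in> {-1..1} \<and> p x \<in> W")
      case True
      hence xV: "x \<in> V" using inj by blast
      show ?thesis
      proof (cases "x \<in> {-t..t}")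
        case x: True
        hence "p' t \<le> p' x" using t by (intro p'_mono) auto
        thus ?thesis using True x xV p'_nonneg[of t] t by (simp flip: ennreal_plus)
      next
        case x: False
        hence "p' x \<le> p' t" using True t by (intro p'_mono) auto
        thus ?thesis using True x xV by (simp add: ennreal_leI)
      qed
    next
      case False
      thus ?thesis by (auto simp: indicator_def)
    qed
  qed
  also have "\<dots> = (\<integral>\<^sup>+x. ennreal (p' x - p' t) * indicator {-t..t} x \<partial>lborel) + ennreal (p' t) * emeasure lborel V"
  proof -
    have [measurable]: "p' \<in> borel_measurable borel" by (rule borel_measurable_continuous_onI[OF contp'])
    show ?thesis using V(1) by (simp add: nn_integral_add nn_integral_cmult)
  qed
  also have "(\<integral>\<^sup>+x. ennreal (p' x - p' t) * indicator {-t..t} x \<partial>lborel)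
      = ennreal ((p t - p' t * t) - (p (-t) - p' t * (-t)))"
  proof (rule nn_integral_FTC_Icc[where F = "\<lambda>x. p x - p' t * x"])
    show "(\<lambda>x. p' x - p' t) \<in> borel_measurable borel"
      by (intro borel_measurable_continuous_onI continuous_intros contp')
    show "((\<lambda>x. p x - p' t * x) has_real_derivative p' x - p' t) (at x)" for x
      by (auto intro!: derivative_eq_intros der)
    show "0 \<le> p' x - p' t" if "x \<in> {-t..t}" for x
      using p'_mono[of x t] that t by auto
  qed (use t in auto)
  also have "ennreal ((p t - p' t * t) - (p (-t) - p' t * (-t))) + ennreal (p' t) * emeasure lborel V
     \<le> ennreal ((p t - p' t * t) - (p (-t) - p' t * (-t))) + ennreal (p' t) * ennreal (2 * t)"
    by (intro add_left_mono mult_left_mono V(3)) auto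
  also have "\<dots> = ennreal (8 * t / (1 + t\<^sup>2))"
  proof -
    have "p' t * t \<le> p t"
    proof -
      have "(1 - t\<^sup>2) * t \<le> 1 * t" using t by (intro mult_right_mono) auto
      also have "\<dots> \<le> t * (1 + t\<^sup>2)" using t by (simp add: algebra_simps)
      finally show ?thesis unfolding p_def p'_def using nz(2)[of t] t
        by (simp add: divide_simps power2_eq_square add_pos_nonneg)
    qed
    moreover have "p (-t) = - p t" by (simp add: p_def)
    ultimately have "(p t - p' t * t) - (p (-t) - p' t * (-t)) \<ge> 0" by (simp add: mult.commute)
    hence "ennreal ((p t - p' t * t) - (p (-t) - p' t * (-t))) + ennreal (p' t) * ennreal (2 * t)
        = ennreal ((p t - p' t * t) - (p (-t) - p' t * (-t)) + p' t * (2 * t))"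
      using p'_nonneg[of t] t by (subst ennreal_mult[symmetric], simp, simp, subst ennreal_plus) auto
    thus ?thesis by (simp add: p_def)
  qed
  finally show ?thesis .
qed

text \<open>With 1 - f = h e, everything comes from 4 w / (1 - w^2) = 2 / (1 - w) - 2 / (1 + w): the
  first term has the pole, the second supplies the -1 and the - a / 2. The third limit is the
  coefficient of h in \<open>K\<close>; its part \<alpha>^2 - a3 / a is the Schwarzian divided by
  -6.\<close>

lemma radial_expansion_twofold_slit_map:
  assumes exp: "boundary_expansion f (of_real a) a2 a3" and a: "a > 0"
  defines "\<alpha> \<equiv> a2 / of_real a" and "K \<equiv> (\<lambda>h. twofold_slit_map (f (1 - complex_of_real h)))"
  shows "((\<lambda>h. (1 - f (1 - of_real h)) / of_real h) \<longlongrightarrow> of_real a) (at_right 0)"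
    and "((\<lambda>h. of_real h * K h) \<longlongrightarrow> of_real (2 / a)) (at_right 0)"
    and "((\<lambda>h. (K h - (of_real (2 / a) * (1 / of_real h + \<alpha>) - 1)) / of_real h)
           \<longlongrightarrow> of_real (2 / a) * (\<alpha>\<^sup>2 - a3 / of_real a) - of_real (a / 2)) (at_right 0)"
proof -
  let ?F = "at_right (0 :: real)"
  let ?a = "complex_of_real a"
  obtain r where r: "(r \<longlongrightarrow> a3) ?F"
    and fr: "\<And>h. h \<noteq> 0 \<Longrightarrow> f (1 - of_real h) = 1 - of_real h * (?a + of_real h * (- a2 + of_real h * r h))"
    using boundary_expansion_radial[OF exp] by blast
  define e1 where "e1 = (\<lambda>h. - a2 + of_real h * r h)"
  define e where "e = (\<lambda>h. ?a + of_real h * e1 h)"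
  have h0: "((\<lambda>h. complex_of_real h) \<longlongrightarrow> 0) ?F"
    using tendsto_of_real[OF tendsto_ident_at[of 0 "{0<..}"], where 'a = complex] by simp
  have "(e1 \<longlongrightarrow> - a2 + 0 * a3) ?F" unfolding e1_def by (intro tendsto_intros h0 r)
  hence e1: "(e1 \<longlongrightarrow> - a2) ?F" by simp
  have "(e \<longlongrightarrow> ?a + 0 * (- a2)) ?F" unfolding e_def by (intro tendsto_intros h0 e1)
  hence e: "(e \<longlongrightarrow> ?a) ?F" by simp
  have a0: "?a \<noteq> 0" using a by simp
  have fe: "f (1 - of_real h) = 1 - of_real h * e h" if "h \<noteq> 0" for h
    using fr[OF that] by (simp add: e_def e1_def)
  have ev: "eventually (\<lambda>h. h > 0 \<and> e h \<noteq> 0 \<and> 2 - of_real h * e h \<noteq> 0) ?F"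
  proof -
    have "((\<lambda>h. 2 - of_real h * e h) \<longlongrightarrow> 2 - 0 * ?a) ?F" by (intro tendsto_intros h0 e)
    hence "eventually (\<lambda>h. 2 - of_real h * e h \<noteq> 0) ?F" by (rule tendsto_imp_eventually_ne) simp
    moreover have "eventually (\<lambda>h. e h \<noteq> 0) ?F" by (rule tendsto_imp_eventually_ne[OF e a0])
    ultimately show ?thesis using eventually_at_right_less[of 0] by eventually_elim auto
  qed
  have Ke: "K h = 2 / (of_real h * e h) - 2 / (2 - of_real h * e h)"
    if "h > 0" "e h \<noteq> 0" "2 - of_real h * e h \<noteq> 0" for h
  proof -
    have "1 - (1 - of_real h * e h)\<^sup>2 = of_real h * e h * (2 - of_real h * e h)"
      by (simp add: power2_eq_square algebra_simps)
    thus ?thesis using that unfolding K_def twofold_slit_map_def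
      by (simp add: fe divide_simps)
  qed
  show "((\<lambda>h. (1 - f (1 - of_real h)) / of_real h) \<longlongrightarrow> ?a) ?F"
  proof (rule Lim_transform_eventually[OF e])
    show "eventually (\<lambda>h. e h = (1 - f (1 - of_real h)) / of_real h) ?F"
      using ev by eventually_elim (simp add: fe)
  qed
  have "((\<lambda>h. 2 / e h - of_real h * (2 / (2 - of_real h * e h))) \<longlongrightarrow> 2 / ?a - 0 * (2 / (2 - 0 * ?a))) ?F"
    using a0 by (intro tendsto_intros h0 e) auto
  hence lim: "((\<lambda>h. 2 / e h - of_real h * (2 / (2 - of_real h * e h))) \<longlongrightarrow> of_real (2 / a)) ?F" by simp
  show "((\<lambda>h. of_real h * K h) \<longlongrightarrow> of_real (2 / a)) ?F"
  proof (rule Lim_transform_eventually[OF lim])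
    show "eventually (\<lambda>h. 2 / e h - of_real h * (2 / (2 - of_real h * e h)) = of_real h * K h) ?F"
      using ev by eventually_elim (simp add: Ke right_diff_distrib)
  qed
  have "((\<lambda>h. 2 * (- ?a * r h - a2 * e1 h) / (?a\<^sup>2 * e h) - e h / (2 - of_real h * e h)) \<longlongrightarrow>
      2 * (- ?a * a3 - a2 * (- a2)) / (?a\<^sup>2 * ?a) - ?a / (2 - 0 * ?a)) ?F"
    using a0 by (intro tendsto_intros h0 e e1 r) auto
  also have "2 * (- ?a * a3 - a2 * (- a2)) / (?a\<^sup>2 * ?a) - ?a / (2 - 0 * ?a)
      = of_real (2 / a) * (\<alpha>\<^sup>2 - a3 / ?a) - of_real (a / 2)"
    using a0 by (simp add: \<alpha>_def divide_simps power2_eq_square)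
  finally have lim2: "((\<lambda>h. 2 * (- ?a * r h - a2 * e1 h) / (?a\<^sup>2 * e h) - e h / (2 - of_real h * e h)) \<longlongrightarrow>
      of_real (2 / a) * (\<alpha>\<^sup>2 - a3 / ?a) - of_real (a / 2)) ?F" .
  show "((\<lambda>h. (K h - (of_real (2 / a) * (1 / of_real h + \<alpha>) - 1)) / of_real h)
           \<longlongrightarrow> of_real (2 / a) * (\<alpha>\<^sup>2 - a3 / of_real a) - of_real (a / 2)) ?F"
  proof (rule Lim_transform_eventually[OF lim2])
    show "eventually (\<lambda>h. 2 * (- ?a * r h - a2 * e1 h) / (?a\<^sup>2 * e h) - e h / (2 - of_real h * e h)
        = (K h - (of_real (2 / a) * (1 / of_real h + \<alpha>) - 1)) / of_real h) ?F"
      using ev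
    proof eventually_elim
      case (elim h)
      define H where "H = complex_of_real h"
      have nz: "H \<noteq> 0" "e h \<noteq> 0" "2 - H * e h \<noteq> 0" using elim by (auto simp: H_def)
      have "1 - 2 / (2 - H * e h) = - H * (e h / (2 - H * e h))"
        using nz by (simp add: field_simps)
      moreover have "2 / (H * e h) - 2 / ?a * (1 / H + \<alpha>) = H * (2 * (- ?a * r h - a2 * e1 h) / (?a\<^sup>2 * e h))"
      proof -
        have "2 / (H * e h) - 2 / ?a * (1 / H + \<alpha>) = 2 * (?a\<^sup>2 - ?a * e h - a2 * H * e h) / (H * e h * ?a\<^sup>2)"
          using nz a0 by (simp add: \<alpha>_def divide_simps power2_eq_square) (simp add: algebra_simps)
        also have "?a\<^sup>2 - ?a * e h - a2 * H * e h = H * H * (- ?a * r h - a2 * e1 h)"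
          by (simp add: e_def e1_def H_def power2_eq_square algebra_simps)
        finally show ?thesis using nz a0 by (simp add: divide_simps)
      qed
      ultimately have "K h - (2 / ?a * (1 / H + \<alpha>) - 1)
          = H * (2 * (- ?a * r h - a2 * e1 h) / (?a\<^sup>2 * e h) - e h / (2 - H * e h))"
        unfolding Ke[OF elim[THEN conjunct1] elim[THEN conjunct2, THEN conjunct1] elim[THEN conjunct2, THEN conjunct2], folded H_def]
        by (simp add: algebra_simps)
      thus ?case using nz by (simp add: H_def)
    qed
  qed
qed

section \<open>The branch of sqrt (J^2 + l^2) on the slit plane\<close>

definition gap_root :: "real \<Rightarrow> complex \<Rightarrow> complex" where
  "gap_root l J = csqrt (J\<^sup>2 + of_real (l\<^sup>2))"

lemma gap_root_square: "(gap_root l J)\<^sup>2 = J\<^sup>2 + of_real (l\<^sup>2)"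
  by (simp add: gap_root_def)

text \<open>A value on the cut of the square root makes J^2 real and at most - l^2, so J lies on the
  imaginary axis outside (-l, l). Off these two slits \<open>gap_root\<close> is holomorphic with
  positive real part.\<close>

lemma gap_root_slit_plane:
  assumes "Re J \<noteq> 0 \<or> \<bar>Im J\<bar> < l"
  shows "J\<^sup>2 + of_real (l\<^sup>2) \<notin> \<real>\<^sub>\<le>\<^sub>0"
proof
  assume "J\<^sup>2 + of_real (l\<^sup>2) \<in> \<real>\<^sub>\<le>\<^sub>0"
  hence *: "2 * Re J * Im J = 0" "(Re J)\<^sup>2 - (Im J)\<^sup>2 + l\<^sup>2 \<le> 0"
    by (auto simp: complex_nonpos_Reals_iff Re_power2 Im_power2)
  show False
  proof (cases "Re J = 0")
    case True
    hence "\<bar>Im J\<bar>\<^sup>2 < l\<^sup>2" using assms by (intro power_strict_mono) auto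
    thus False using * True by simp
  next
    case False
    hence "Im J = 0" "(Re J)\<^sup>2 > 0" using * by auto
    thus False using * by (smt (verit) zero_le_power2 zero_power2)
  qed
qed

lemma gap_root_Re_pos:
  assumes "Re J \<noteq> 0 \<or> \<bar>Im J\<bar> < l"
  shows "Re (gap_root l J) > 0"
proof -
  have "Re (gap_root l J) \<noteq> 0"
  proof
    assume "Re (gap_root l J) = 0"
    hence "(gap_root l J)\<^sup>2 \<in> \<real>\<^sub>\<le>\<^sub>0"
      by (simp add: complex_nonpos_Reals_iff Re_power2 Im_power2)
    thus False using gap_root_slit_plane[OF assms] by (simp add: gap_root_square)
  qed
  moreover have "Re (gap_root l J) \<ge> 0" unfolding gap_root_def using csqrt_principal[of "J\<^sup>2 + of_real (l\<^sup>2)"] by auto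
  ultimately show ?thesis by simp
qed

lemma holomorphic_on_gap_root:
  "gap_root l holomorphic_on {J. Re J \<noteq> 0 \<or> \<bar>Im J\<bar> < l}"
  unfolding gap_root_def using gap_root_slit_plane by (intro holomorphic_intros) auto

section \<open>The extremal function\<close>

lemma twofold_slit_map_divide_eq_iff:
  assumes "norm z < 1" "norm w < 1" "a \<noteq> 0"
  shows "twofold_slit_map z / a = twofold_slit_map w \<longleftrightarrow> z * (1 - w\<^sup>2) = a * w * (1 - z\<^sup>2)"
proof -
  have "twofold_slit_map z / a = twofold_slit_map w \<longleftrightarrow> 4 * (z / ((1 - z\<^sup>2) * a)) = 4 * (w / (1 - w\<^sup>2))"
    by (simp add: twofold_slit_map_def)
  also have "\<dots> \<longleftrightarrow> z / ((1 - z\<^sup>2) * a) = w / (1 - w\<^sup>2)"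
    by (simp only: mult_cancel_left) simp
  also have "\<dots> \<longleftrightarrow> z * (1 - w\<^sup>2) = a * w * (1 - z\<^sup>2)"
    using square_neq_1[OF assms(1)] square_neq_1[OF assms(2)] assms(3)
    by (subst frac_eq_eq) (simp_all add: mult_ac)
  finally show ?thesis .
qed

text \<open>The only other solution with the same value is - 1 / w, which lies outside the
  disk.\<close>

lemma inj_on_twofold_slit_map: "inj_on twofold_slit_map (ball 0 1)"
proof (rule inj_onI)
  fix v w assume *: "v \<in> ball 0 1" "w \<in> ball 0 1" "twofold_slit_map v = twofold_slit_map w"
  hence "v * (1 - w\<^sup>2) = w * (1 - v\<^sup>2)"
    using twofold_slit_map_divide_eq_iff[of v w 1] by simp
  hence "(v - w) * (1 + v * w) = 0" by (simp add: power2_eq_square algebra_simps)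
  moreover have "1 + v * w \<noteq> 0"
  proof
    assume "1 + v * w = 0"
    hence "v * w = - 1" by (simp add: add_eq_0_iff)
    hence "norm (v * w) = 1" by simp
    moreover have "norm v * norm w < 1 * 1" using * by (intro mult_strict_mono') auto
    ultimately show False by (simp add: norm_mult)
  qed
  ultimately show "v = w" by simp
qed

lemma twofold_slit_map_in_slit_plane:
  assumes "norm w < 1"
  shows "Re (twofold_slit_map w) \<noteq> 0 \<or> \<bar>Im (twofold_slit_map w)\<bar> < 2"
proof (cases "Re (twofold_slit_map w) = 0")
  case True
  hence w: "w = \<i> * of_real (Im w)" using assms by (simp add: Re_twofold_slit_map_eq_0_iff complex_eq_iff)
  define y where "y = Im w"
  have y: "\<bar>y\<bar> < 1" using abs_Im_le_cmod[of w] assms by (simp add: y_def)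
  have "(1 - \<bar>y\<bar>)\<^sup>2 > 0" using y by simp
  hence "4 * \<bar>y\<bar> < 2 * (1 + y\<^sup>2)" by (simp add: power2_eq_square algebra_simps)
  moreover have "1 + y\<^sup>2 > 0" by (simp add: add_pos_nonneg)
  ultimately have "\<bar>4 * y / (1 + y\<^sup>2)\<bar> < 2" by (simp add: abs_divide abs_mult field_simps)
  moreover have "twofold_slit_map w = \<i> * of_real (4 * y / (1 + y\<^sup>2))"
    using twofold_slit_map_imaginary[of y] w by (simp only: y_def)
  hence "Im (twofold_slit_map w) = 4 * y / (1 + y\<^sup>2)" by simp
  ultimately show ?thesis by simp
qed simp

text \<open>The root (R - 2) / J of J w^2 + 4 w - J = 0 with R = \<open>gap_root 2 J\<close>,
  rewritten by J^2 = (R - 2) (R + 2) so that J = 0 causes no division by 0. Positivity of Re R gives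
  |R - 2| < |R + 2|, which selects the root in the disk.\<close>

definition twofold_slit_inverse :: "complex \<Rightarrow> complex" where
  "twofold_slit_inverse J = J / (2 + gap_root 2 J)"

lemma
  assumes J: "Re J \<noteq> 0 \<or> \<bar>Im J\<bar> < 2"
  shows norm_twofold_slit_inverse: "norm (twofold_slit_inverse J) < 1"
    and twofold_slit_map_inverse: "twofold_slit_map (twofold_slit_inverse J) = J"
proof -
  define R where "R = gap_root 2 J"
  have Rpos: "Re R > 0" unfolding R_def by (rule gap_root_Re_pos[OF J])
  have J2: "J\<^sup>2 = (R - 2) * (R + 2)"
    using gap_root_square[of 2 J] by (simp add: R_def power2_eq_square algebra_simps)
  have nz: "R + 2 \<noteq> 0" using Rpos by (auto simp: complex_eq_iff)
  have "(norm (R - 2))\<^sup>2 < (norm (R + 2))\<^sup>2"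
    unfolding cmod_power2 using Rpos by (simp add: power2_eq_square algebra_simps)
  hence "norm (R - 2) < norm (R + 2)" by (rule power2_less_imp_less) simp
  hence "norm (R - 2) * norm (R + 2) < norm (R + 2) * norm (R + 2)"
    using nz by (intro mult_strict_right_mono) auto
  hence "(norm J)\<^sup>2 < (norm (R + 2))\<^sup>2"
    by (metis J2 norm_mult norm_power power2_eq_square)
  hence "norm J < norm (R + 2)" by (rule power2_less_imp_less) simp
  thus "norm (twofold_slit_inverse J) < 1"
    using nz by (simp add: twofold_slit_inverse_def R_def norm_divide add.commute)
  have "1 - (J / (R + 2))\<^sup>2 = 4 / (R + 2)"
    unfolding power_divide J2 using nz by (simp add: divide_simps power2_eq_square)
  thus "twofold_slit_map (twofold_slit_inverse J) = J"
    using nz by (simp add: twofold_slit_map_def twofold_slit_inverse_def R_def add.commute)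
qed

definition slit_scale :: "real \<Rightarrow> real" where
  "slit_scale t = 2 * t / (1 + t\<^sup>2)"

lemma slit_equation_iff:
  "slit_equation t z w \<longleftrightarrow> of_real (slit_scale t) * twofold_slit_map z = twofold_slit_map w"
  unfolding slit_equation_def slit_scale_def[symmetric]
  unfolding twofold_slit_map_def times_divide_eq_right[symmetric] mult.left_commute[of _ 4]
  by (simp only: mult_cancel_left) simp

text \<open>\<open>g\<close> is known only implicitly, so it is compared with a candidate polynomial
  \<open>p\<close> that solves z (1 - w^2) = a w (1 - z^2) up to h^4 q, h = z - 1. Subtracting the
  two equations gives (g - p) D = h^4 q with D tending to 2, an estimate valid for every approach to
  1 within the disk.\<close>

lemma boundary_expansion_slit_equation:
  fixes a :: real
  assumes a: "a > 0"
    and g: "\<And>z. z \<in> ball 0 1 \<Longrightarrow> norm (g z) < 1 \<and> twofold_slit_map z / of_real a = twofold_slit_map (g z)"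
  shows "boundary_expansion g (of_real a) (of_real ((a\<^sup>2 - a) / 2)) (of_real (- (a\<^sup>2 - a) / 2))"
proof -
  let ?F = "at (1::complex) within ball 0 1"
  let ?a = "complex_of_real a"
  have idl: "((\<lambda>z. z) \<longlongrightarrow> 1) ?F" by (rule tendsto_ident_at)
  have inball: "eventually (\<lambda>z. z \<in> ball 0 1 \<and> z \<noteq> 1) ?F"
    by (auto simp: eventually_at_filter)
  have Repos: "eventually (\<lambda>z. Re z > 0) ?F"
    by (rule order_tendstoD(1)[OF tendsto_Re[OF idl]]) simp
  have near: "(g \<longlongrightarrow> 1) ?F"
  proof -
    have "((\<lambda>z. 1 - g z) \<longlongrightarrow> 0) ?F"
    proof (rule Lim_null_comparison)
      show "eventually (\<lambda>z. norm (1 - g z) \<le> a * norm (1 - z\<^sup>2) / norm z) ?F"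
        using inball Repos
      proof eventually_elim
        case (elim z)
        define w where "w = g z"
        have z: "norm z < 1" and w: "norm w < 1" and eq: "twofold_slit_map z / ?a = twofold_slit_map w"
          using g[of z] elim by (auto simp: w_def)
        have nz: "1 - z\<^sup>2 \<noteq> 0" "1 - w\<^sup>2 \<noteq> 0" 
          using square_neq_1[of z] square_neq_1[of w] z w by simp_all
        have z0: "z \<noteq> 0" using elim by auto
        \<comment> \<open>Large values of the slit map occur near 1 and near -1; the sign of the
          real part, which the map preserves, rules out -1 for \<open>w\<close>.\<close>
        have "Re (twofold_slit_map z) > 0"
        proof -
          have "(norm z)\<^sup>2 < 1" using z by (simp add: power_less_one_iff)
          thus ?thesis using elim nz by (simp add: Re_twofold_slit_map)
        qed
        hence "Re (twofold_slit_map w) > 0" using a by (simp flip: eq add: Re_divide_of_real)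
        hence Rew: "Re w > 0"
        proof -
          have "(norm w)\<^sup>2 < 1" using w by (simp add: power_less_one_iff)
          thus ?thesis using \<open>Re (twofold_slit_map w) > 0\<close> nz
            by (auto simp: Re_twofold_slit_map zero_less_mult_iff zero_less_divide_iff)
        qed
        have "z * (1 - w\<^sup>2) = ?a * w * (1 - z\<^sup>2)"
          using eq z w a by (simp add: twofold_slit_map_divide_eq_iff)
        hence "norm z * norm (1 - w\<^sup>2) = a * norm w * norm (1 - z\<^sup>2)"
          using a by (metis abs_of_pos norm_mult norm_of_real)
        hence *: "norm (1 - w\<^sup>2) = a * norm w * norm (1 - z\<^sup>2) / norm z"
          using z0 by (simp add: field_simps)
        have "1 \<le> norm (1 + w)" using Rew abs_Re_le_cmod[of "1 + w"] by simp
        hence "norm (1 - w) * 1 \<le> norm (1 - w) * norm (1 + w)" by (intro mult_left_mono) auto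
        also have "\<dots> = norm (1 - w\<^sup>2)" by (simp flip: norm_mult add: power2_eq_square algebra_simps)
        also have "\<dots> \<le> a * 1 * norm (1 - z\<^sup>2) / norm z"
          unfolding * using a w by (intro divide_right_mono mult_right_mono mult_left_mono) auto
        finally show ?case by (simp add: w_def)
      qed
      have "((\<lambda>z. a * norm (1 - z\<^sup>2) / norm z) \<longlongrightarrow> a * norm (1 - (1::complex)\<^sup>2) / norm (1::complex)) ?F"
        by (intro tendsto_intros idl) auto
      thus "((\<lambda>z. a * norm (1 - z\<^sup>2) / norm z) \<longlongrightarrow> 0) ?F" by simp
    qed
    from tendsto_diff[OF tendsto_const[of 1] this] show ?thesis by simp
  qed
  \<comment> \<open>Undetermined coefficients: inserting 1 + a h + m h^2 + n h^3 into the equation,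
    this m and n = - m cancel all terms below h^4, and \<open>q\<close> is the cofactor of h^4 in
    the residual.\<close>
  define m where "m = (?a\<^sup>2 - ?a) / 2"
  define p where "p = (\<lambda>z. 1 + ?a * (z - 1) + m * (z - 1) ^ 2 + (- m) * (z - 1) ^ 3)"
  define q where "q = (\<lambda>h. (2 * m - ?a * m - m\<^sup>2) + (m\<^sup>2 + ?a * m) * h + m\<^sup>2 * h\<^sup>2 - m\<^sup>2 * h ^ 3)"
  define D where "D = (\<lambda>z. z * (p z + g z) + ?a * (1 - z\<^sup>2))"
  have "(p \<longlongrightarrow> 1 + ?a * (1 - 1) + m * (1 - 1) ^ 2 + (- m) * (1 - 1) ^ 3) ?F"
    unfolding p_def by (intro tendsto_intros idl)
  hence plim: "(p \<longlongrightarrow> 1) ?F" by simp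
  have "(D \<longlongrightarrow> 1 * (1 + 1) + ?a * (1 - 1\<^sup>2)) ?F"
    unfolding D_def by (intro tendsto_intros idl plim near)
  hence Dlim: "(D \<longlongrightarrow> 2) ?F" by simp
  have "((\<lambda>z. (z - 1) * q (z - 1) / D z) \<longlongrightarrow> (1 - 1) * q (1 - 1) / 2) ?F"
    unfolding q_def by (intro tendsto_intros idl Dlim) auto
  hence lim: "((\<lambda>z. (z - 1) * q (z - 1) / D z) \<longlongrightarrow> 0) ?F" by simp
  have ev: "eventually (\<lambda>z. (z - 1) * q (z - 1) / D z = (g z - p z) / (z - 1) ^ 3) ?F"
    using inball tendsto_imp_eventually_ne[OF Dlim, of 0, simplified]
  proof eventually_elim
    case (elim z)
    define h where "h = z - 1"
    have z: "z = 1 + h" and h0: "h \<noteq> 0" using elim by (auto simp: h_def)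
    have w: "z * (1 - (g z)\<^sup>2) = ?a * g z * (1 - z\<^sup>2)"
      using twofold_slit_map_divide_eq_iff[of z "g z" ?a] g[of z] elim a by auto
    have p: "z * (1 - (p z)\<^sup>2) - ?a * p z * (1 - z\<^sup>2) = h ^ 4 * q h"
    proof -
      have m: "2 * m = ?a\<^sup>2 - ?a" by (simp add: m_def)
      have pz: "p z = 1 + ?a * h + m * h ^ 2 - m * h ^ 3" by (simp add: p_def h_def)
      show ?thesis unfolding pz q_def unfolding z using m by algebra
    qed
    have "(g z - p z) * D z = h ^ 4 * q h"
      using w p unfolding D_def by algebra
    hence "(g z - p z) * D z = h ^ 3 * (h * q h)" by (simp add: eval_nat_numeral mult_ac)
    thus ?case using elim h0 unfolding h_def[symmetric] by (simp add: frac_eq_eq mult_ac)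
  qed
  have main: "((\<lambda>z. (g z - p z) / (z - 1) ^ 3) \<longlongrightarrow> 0) ?F"
    by (rule Lim_transform_eventually[OF lim ev])
  show ?thesis
    unfolding boundary_expansion_def
  proof (intro allI impI)
    fix \<alpha> :: real
    have sub: "stolz_angle \<alpha> \<subseteq> ball 0 1" by (auto simp: stolz_angle_def)
    have "((\<lambda>z. (g z - p z) / (z - 1) ^ 3) \<longlongrightarrow> 0) (at 1 within stolz_angle \<alpha>)"
      by (rule tendsto_within_subset[OF main sub])
    hence "(\<lambda>z. g z - p z) \<in> o[at 1 within stolz_angle \<alpha>](\<lambda>z. (z - 1) ^ 3)"
      by (rule smalloI_tendsto) (auto simp: eventually_at_filter)
    thus "(\<lambda>z. g z - (1 + ?a * (z - 1) + of_real ((a\<^sup>2 - a) / 2) * (z - 1) ^ 2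
        + of_real (- (a\<^sup>2 - a) / 2) * (z - 1) ^ 3)) \<in> o[at 1 within stolz_angle \<alpha>](\<lambda>z. (z - 1) ^ 3)"
      by (simp add: p_def m_def minus_divide_left del: minus_divide_left[symmetric])
  qed
qed

section \<open>Mapping properties of the extremal function\<close>

context
  fixes t :: real
  assumes t: "0 < t" "t < 1"
begin

lemma slit_factor: "0 < slit_scale t" "slit_scale t < 1"
proof -
  have pos: "1 + t\<^sup>2 > 0" by (simp add: add_pos_nonneg)
  thus "0 < slit_scale t" using t by (simp add: slit_scale_def)
  have "(1 - t)\<^sup>2 > 0" using t by simp
  thus "slit_scale t < 1" using pos by (simp add: slit_scale_def power2_eq_square algebra_simps)
qed

lemma slit_target:
  assumes "norm z < 1"
  shows "Re (of_real (slit_scale t) * twofold_slit_map z) \<noteq> 0 \<or>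
         \<bar>Im (of_real (slit_scale t) * twofold_slit_map z)\<bar> < 2 * (slit_scale t)"
  using twofold_slit_map_in_slit_plane[OF assms] slit_factor
  by (auto simp: abs_mult)

lemma slit_target':
  assumes "norm z < 1"
  shows "Re (of_real (slit_scale t) * twofold_slit_map z) \<noteq> 0 \<or>
         \<bar>Im (of_real (slit_scale t) * twofold_slit_map z)\<bar> < 2"
  using slit_target[OF assms] slit_factor by linarith

lemma ex1_slit_equation:
  assumes "z \<in> ball 0 1"
  shows "\<exists>!w. w \<in> ball 0 1 \<and> slit_equation t z w"
proof (rule ex1I)
  let ?J = "of_real (slit_scale t) * twofold_slit_map z"
  have J: "Re ?J \<noteq> 0 \<or> \<bar>Im ?J\<bar> < 2" using assms by (intro slit_target') simp
  show "twofold_slit_inverse ?J \<in> ball 0 1 \<and> slit_equation t z (twofold_slit_inverse ?J)"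
    using norm_twofold_slit_inverse[OF J] twofold_slit_map_inverse[OF J] by (simp add: slit_equation_iff)
  fix w assume "w \<in> ball 0 1 \<and> slit_equation t z w"
  thus "w = twofold_slit_inverse ?J"
    using norm_twofold_slit_inverse[OF J] twofold_slit_map_inverse[OF J]
    by - (rule inj_onD[OF inj_on_twofold_slit_map], auto simp: slit_equation_iff)
qed

lemma
  assumes "z \<in> ball 0 1"
  shows norm_slit_map: "norm (slit_map t z) < 1"
    and twofold_slit_map_slit_map: "twofold_slit_map (slit_map t z) = of_real (slit_scale t) * twofold_slit_map z"
  using theI'[OF ex1_slit_equation[OF assms]] by (simp_all add: slit_map_def slit_equation_iff)

lemma slit_map_eq:
  assumes "z \<in> ball 0 1"
  shows "slit_map t z = twofold_slit_inverse (of_real (slit_scale t) * twofold_slit_map z)"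
proof -
  let ?J = "of_real (slit_scale t) * twofold_slit_map z"
  have J: "Re ?J \<noteq> 0 \<or> \<bar>Im ?J\<bar> < 2" using assms by (intro slit_target') simp
  show ?thesis
    using norm_twofold_slit_inverse[OF J] twofold_slit_map_inverse[OF J] norm_slit_map[OF assms]
      twofold_slit_map_slit_map[OF assms]
    by - (rule inj_onD[OF inj_on_twofold_slit_map], auto)
qed

lemma holomorphic_on_slit_map: "slit_map t holomorphic_on ball 0 1"
proof -
  let ?S = "{J. Re J \<noteq> 0 \<or> \<bar>Im J\<bar> < 2}"
  have "2 + gap_root 2 J \<noteq> 0" if "J \<in> ?S" for J
    using gap_root_Re_pos[of J 2] that by (auto simp: complex_eq_iff)
  hence "twofold_slit_inverse holomorphic_on ?S"
    unfolding twofold_slit_inverse_def[abs_def] by (intro holomorphic_intros holomorphic_on_gap_root) auto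
  hence "twofold_slit_inverse \<circ> (\<lambda>z. of_real (slit_scale t) * twofold_slit_map z) holomorphic_on ball 0 1"
  proof (rule holomorphic_on_compose_gen[rotated])
    show "(\<lambda>z. of_real (slit_scale t) * twofold_slit_map z) ` ball 0 1 \<subseteq> ?S"
      using slit_target' by (intro image_subsetI CollectI) simp
  qed (intro holomorphic_intros holomorphic_on_twofold_slit_map)
  thus ?thesis
    by (rule holomorphic_transform) (simp add: slit_map_eq)
qed

lemma inj_on_slit_map: "inj_on (slit_map t) (ball 0 1)"
proof (rule inj_onI)
  fix v w assume *: "v \<in> ball 0 1" "w \<in> ball 0 1" "slit_map t v = slit_map t w"
  hence "of_real (slit_scale t) * twofold_slit_map v = of_real (slit_scale t) * twofold_slit_map w"
    using twofold_slit_map_slit_map by metis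
  hence "twofold_slit_map v = twofold_slit_map w" using slit_factor(1) by (simp only: mult_cancel_left of_real_eq_0_iff) auto
  thus "v = w" using *(1,2) by (rule inj_onD[OF inj_on_twofold_slit_map])
qed

text \<open>Twice \<open>slit_scale t\<close> is the value of 4 y / (1 + y^2) at y = t, and this
  function increases for |y| < 1. So the tips i t and - i t correspond to the ends of the scaled
  gap.\<close>

lemma imaginary_slit_iff:
  assumes "\<bar>y\<bar> < 1"
  shows "\<bar>4 * y / (1 + y\<^sup>2)\<bar> < 2 * (slit_scale t) \<longleftrightarrow> \<bar>y\<bar> < t"
proof -
  have pos: "1 + y\<^sup>2 > 0" "1 + t\<^sup>2 > 0" by (simp_all add: add_pos_nonneg)
  have "\<bar>y\<bar> * t < 1 * 1" using assms t by (intro mult_strict_mono) auto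
  have "\<bar>4 * y / (1 + y\<^sup>2)\<bar> < 2 * (slit_scale t) \<longleftrightarrow> 4 * \<bar>y\<bar> / (1 + y\<^sup>2) < 4 * t / (1 + t\<^sup>2)"
    using pos by (simp add: abs_divide abs_mult slit_scale_def)
  also have "\<dots> \<longleftrightarrow> 4 * \<bar>y\<bar> * (1 + t\<^sup>2) < 4 * t * (1 + y\<^sup>2)"
    using pos by (simp add: pos_divide_less_eq pos_less_divide_eq mult_ac)
  also have "\<dots> \<longleftrightarrow> (\<bar>y\<bar> - t) * (1 - \<bar>y\<bar> * t) < 0"
  proof -
    have "4 * t * (1 + y\<^sup>2) - 4 * \<bar>y\<bar> * (1 + t\<^sup>2) = - 4 * ((\<bar>y\<bar> - t) * (1 - \<bar>y\<bar> * t))"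
      by (simp add: power2_eq_square algebra_simps)
    thus ?thesis by linarith
  qed
  also have "\<dots> \<longleftrightarrow> \<bar>y\<bar> < t" using \<open>\<bar>y\<bar> * t < 1 * 1\<close> by (simp add: mult_less_0_iff)
  finally show ?thesis .
qed

text \<open>In the image plane of \<open>twofold_slit_map\<close> the map is a scaling by c =
  \<open>slit_scale t\<close>, which shrinks the gap (-2, 2) to (-2 c, 2 c). Conversely the preimage
  of w is found by dividing by c and applying \<open>twofold_slit_inverse\<close>.\<close>

lemma slit_map_image_iff:
  "w \<in> slit_map t ` ball 0 1 \<longleftrightarrow> norm w < 1 \<and> (Re w = 0 \<longrightarrow> \<bar>Im w\<bar> < t)"
proof (cases "norm w < 1")
  case False
  thus ?thesis using norm_slit_map by force
next
  case True
  let ?c = "slit_scale t"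
  have imag: "\<bar>Im (twofold_slit_map w)\<bar> < 2 * ?c \<longleftrightarrow> \<bar>Im w\<bar> < t" if "Re w = 0"
  proof -
    have "w = \<i> * of_real (Im w)" using that by (simp add: complex_eq_iff)
    hence "twofold_slit_map w = \<i> * of_real (4 * Im w / (1 + (Im w)\<^sup>2))"
      using twofold_slit_map_imaginary[of "Im w"] by simp
    hence "Im (twofold_slit_map w) = 4 * Im w / (1 + (Im w)\<^sup>2)" by simp
    moreover have "\<bar>Im w\<bar> < 1" using True abs_Im_le_cmod[of w] by simp
    ultimately show ?thesis using imaginary_slit_iff[of "Im w"] by simp
  qed
  show ?thesis
  proof
    assume "w \<in> slit_map t ` ball 0 1"
    then obtain z where z: "norm z < 1" "w = slit_map t z" by auto
    have "twofold_slit_map w = of_real ?c * twofold_slit_map z"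
      using twofold_slit_map_slit_map[of z] z by simp
    hence "Re (twofold_slit_map w) \<noteq> 0 \<or> \<bar>Im (twofold_slit_map w)\<bar> < 2 * ?c"
      using slit_target[OF z(1)] by simp
    thus "norm w < 1 \<and> (Re w = 0 \<longrightarrow> \<bar>Im w\<bar> < t)"
      using True imag by (auto simp: Re_twofold_slit_map_eq_0_iff)
  next
    assume w: "norm w < 1 \<and> (Re w = 0 \<longrightarrow> \<bar>Im w\<bar> < t)"
    define J where "J = twofold_slit_map w / of_real ?c"
    have "Re J \<noteq> 0 \<or> \<bar>Im J\<bar> < 2"
    proof (cases "Re w = 0")
      case True
      hence "\<bar>Im (twofold_slit_map w)\<bar> < 2 * ?c" using imag w by blast
      moreover have "\<bar>Im J\<bar> = \<bar>Im (twofold_slit_map w)\<bar> / ?c"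
        using slit_factor(1) unfolding J_def Im_divide_of_real by (simp only: abs_divide abs_of_pos)
      ultimately show ?thesis using slit_factor(1) by (simp only: divide_less_eq) simp
    next
      case False
      hence "Re (twofold_slit_map w) \<noteq> 0" using w by (simp add: Re_twofold_slit_map_eq_0_iff)
      hence "Re J \<noteq> 0" using slit_factor(1) unfolding J_def Re_divide_of_real by (simp only: divide_eq_0_iff) simp
      thus ?thesis by simp
    qed
    note J = norm_twofold_slit_inverse[OF this] twofold_slit_map_inverse[OF this]
    define z where "z = twofold_slit_inverse J"
    have z: "z \<in> ball 0 1" using J by (simp add: z_def)
    have "twofold_slit_map (slit_map t z) = of_real ?c * J"
      using twofold_slit_map_slit_map[OF z] J by (simp add: z_def)
    also have "\<dots> = twofold_slit_map w" using slit_factor(1) by (simp add: J_def)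
    finally have "slit_map t z = w"
      using norm_slit_map[OF z] True by - (rule inj_onD[OF inj_on_twofold_slit_map], auto)
    thus "w \<in> slit_map t ` ball 0 1" using z by blast
  qed
qed

end

lemma closed_segment_imaginary:
  assumes "a \<le> b"
  shows "closed_segment (\<i> * complex_of_real a) (\<i> * of_real b) = {w. Re w = 0 \<and> a \<le> Im w \<and> Im w \<le> b}"
proof (intro equalityI subsetI)
  fix w assume "w \<in> closed_segment (\<i> * complex_of_real a) (\<i> * of_real b)"
  then obtain u where u: "0 \<le> u" "u \<le> 1" "w = (1 - u) *\<^sub>R (\<i> * of_real a) + u *\<^sub>R (\<i> * of_real b)"
    by (auto simp: closed_segment_def)
  have "Im w = a + u * (b - a)" "Re w = 0" by (simp_all add: u(3) algebra_simps)
  moreover have "0 \<le> u * (b - a)" "u * (b - a) \<le> 1 * (b - a)"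
    using u assms mult_right_mono[of u 1 "b - a"] by simp_all
  ultimately show "w \<in> {w. Re w = 0 \<and> a \<le> Im w \<and> Im w \<le> b}" by auto
next
  fix w assume w: "w \<in> {w. Re w = 0 \<and> a \<le> Im w \<and> Im w \<le> b}"
  hence "Im w \<in> closed_segment a b" using assms by (simp add: closed_segment_eq_real_ivl)
  then obtain u where u: "0 \<le> u" "u \<le> 1" "Im w = (1 - u) *\<^sub>R a + u *\<^sub>R b"
    by (auto simp: closed_segment_def)
  have "w = (1 - u) *\<^sub>R (\<i> * of_real a) + u *\<^sub>R (\<i> * of_real b)"
    using w u(3) by (simp add: complex_eq_iff)
  thus "w \<in> closed_segment (\<i> * complex_of_real a) (\<i> * of_real b)"
    using u by (auto simp: closed_segment_def)
qed

section \<open>A minimum principle for locally majorized functions\<close>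

text \<open>Superharmonicity in touching form: at each point some local harmonic function lies above
  v and meets it there. The touching function is the real part of a holomorphic one, so that the
  maximum modulus principle takes the place of mean values.\<close>

definition harmonically_majorized_on :: "complex set \<Rightarrow> (complex \<Rightarrow> real) \<Rightarrow> bool" where
  "harmonically_majorized_on S v \<longleftrightarrow>
     (\<forall>z\<in>S. \<exists>d>0. \<exists>g. ball z d \<subseteq> S \<and> g holomorphic_on ball z d \<and>
        (\<forall>y\<in>ball z d. v y \<le> Re (g y)) \<and> v z = Re (g z))"

text \<open>Near the circle v exceeds every negative level, so a negative value forces an interior
  minimum. There Re g, which lies above v and touches it, has a minimum too, hence is constant, and
  v stays at its minimum on a whole disk.\<close>

lemma harmonically_majorized_on_nonneg:
  assumes hm: "harmonically_majorized_on (ball 0 1) v"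
    and cont: "continuous_on (ball 0 1) v"
    and bdry: "\<And>p e. norm p = 1 \<Longrightarrow> e > 0 \<Longrightarrow> eventually (\<lambda>z. v z > - e) (at p within ball 0 1)"
    and z1: "z1 \<in> ball 0 1"
  shows "v z1 \<ge> 0"
proof (rule ccontr)
  assume neg: "\<not> v z1 \<ge> 0"
  define S where "S = {z \<in> ball 0 1. v z \<le> v z1}"
  have "closed S"
    unfolding closed_sequential_limits
  proof (intro allI impI)
    fix X p assume X: "(\<forall>n. X n \<in> S) \<and> X \<longlonglongrightarrow> p"
    have "norm p \<le> 1"
    proof (rule LIMSEQ_le_const2)
      show "(\<lambda>n. norm (X n)) \<longlonglongrightarrow> norm p" using X by (intro tendsto_norm) auto
      show "\<exists>N. \<forall>n\<ge>N. norm (X n) \<le> 1" using X by (auto simp: S_def less_imp_le)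
    qed
    moreover have "norm p \<noteq> 1"
    proof
      assume p: "norm p = 1"
      have "filterlim X (at p within ball 0 1) sequentially"
        unfolding filterlim_at
      proof (intro conjI always_eventually allI)
        show "X n \<noteq> p" for n using X p by (auto simp: S_def dest!: spec[of _ n])
      qed (use X in \<open>auto simp: S_def\<close>)
      moreover have "eventually (\<lambda>z. v z > - (- v z1)) (at p within ball 0 1)"
        using neg by (intro bdry p) auto
      ultimately have "eventually (\<lambda>n. v (X n) > v z1) sequentially"
        by (auto simp: filterlim_iff)
      then obtain n where "v (X n) > v z1" by (auto simp: eventually_sequentially)
      thus False using X by (auto simp: S_def not_less[symmetric])
    qed
    ultimately have pb: "p \<in> ball 0 1" by simp
    have "isCont v p" using cont pb by (simp add: continuous_on_eq_continuous_at)
    hence "(\<lambda>n. v (X n)) \<longlonglongrightarrow> v p" using X by (auto intro: isCont_tendsto_compose)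
    hence "v p \<le> v z1" by (rule LIMSEQ_le_const2) (use X in \<open>auto simp: S_def\<close>)
    thus "p \<in> S" using pb by (simp add: S_def)
  qed
  moreover have "bounded S" by (rule bounded_subset[of "ball 0 1"]) (auto simp: S_def)
  ultimately have S: "compact S" by (simp add: compact_eq_bounded_closed)
  moreover have "z1 \<in> S" using z1 by (simp add: S_def)
  moreover have contS: "continuous_on S v"
    by (rule continuous_on_subset[OF cont]) (auto simp: S_def)
  ultimately obtain zm where zm: "zm \<in> S" "\<And>y. y \<in> S \<Longrightarrow> v zm \<le> v y"
    using continuous_attains_inf[of S v] by auto
  have glob: "v zm \<le> v y" if "y \<in> ball 0 1" for y
    using zm(2)[of y] zm(2)[OF \<open>z1 \<in> S\<close>] that by (force simp: S_def)
  define M where "M = {z \<in> S. v z = v zm}"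
  have "compact M"
  proof -
    have "closed M"
      unfolding M_def using continuous_closed_preimage_constant[OF contS compact_imp_closed[OF S]] .
    moreover have "M = S \<inter> M" by (auto simp: M_def)
    ultimately show ?thesis using compact_Int_closed[OF S] by metis
  qed
  moreover have "M \<noteq> {}" using zm by (auto simp: M_def)
  moreover have "continuous_on M Re" by (intro continuous_intros)
  \<comment> \<open>The minimizer furthest to the right: the disk of minimizers around it contains a
    point further right, a contradiction. This replaces a connectedness argument.\<close>
  ultimately obtain z0 where z0: "z0 \<in> M" "\<And>y. y \<in> M \<Longrightarrow> Re y \<le> Re z0"
    by (blast dest: continuous_attains_sup)
  have z0b: "z0 \<in> ball 0 1" "v z0 = v zm" using z0 by (auto simp: M_def S_def)
  obtain d g where g: "d > 0" "ball z0 d \<subseteq> ball 0 1" "g holomorphic_on ball z0 d"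
    "\<And>y. y \<in> ball z0 d \<Longrightarrow> v y \<le> Re (g y)" "v z0 = Re (g z0)"
    using hm z0b(1) unfolding harmonically_majorized_on_def by metis
  \<comment> \<open>|exp (- g)| = exp (- Re g), so a minimum of Re g is a maximum of the
    modulus.\<close>
  have "(\<lambda>y. exp (- g y)) constant_on ball z0 d"
  proof (rule maximum_modulus_principle[where U = "ball z0 d" and \<xi> = z0])
    show "norm (exp (- g y)) \<le> norm (exp (- g z0))" if "y \<in> ball z0 d" for y
    proof -
      have "v z0 \<le> v y" using glob[of y] that g(2) z0b by auto
      thus ?thesis using g(4)[OF that] g(5) by simp
    qed
  qed (use g in \<open>auto intro!: holomorphic_intros\<close>)
  then obtain c where c: "\<And>y. y \<in> ball z0 d \<Longrightarrow> exp (- g y) = c"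
    by (auto simp: constant_on_def)
  define y where "y = z0 + of_real (d / 2)"
  have y: "y \<in> ball z0 d" using g(1) by (auto simp: y_def dist_norm norm_divide)
  have "norm (exp (- g y)) = norm (exp (- g z0))" using c[OF y] c[of z0] g(1) by simp
  hence "Re (g y) = v zm" using g(5) z0b by simp
  hence "v y \<le> v zm" using g(4)[OF y] by simp
  moreover have "y \<in> ball 0 1" using y g(2) by auto
  ultimately have "y \<in> M" using glob[of y] zm(1) unfolding M_def S_def by (auto intro: order_trans)
  from z0(2)[OF this] g(1) show False by (simp add: y_def)
qed

lemma harmonically_majorized_on_compose_add:
  assumes hm: "harmonically_majorized_on T u" and S: "open S"
    and K: "K holomorphic_on S" "K ` S \<subseteq> T" and h: "h holomorphic_on S"
  shows "harmonically_majorized_on S (\<lambda>z. u (K z) + Re (h z))"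
  unfolding harmonically_majorized_on_def
proof
  fix z assume z: "z \<in> S"
  hence "K z \<in> T" using K(2) by blast
  then obtain d g where g: "d > 0" "g holomorphic_on ball (K z) d"
    "\<And>y. y \<in> ball (K z) d \<Longrightarrow> u y \<le> Re (g y)" "u (K z) = Re (g (K z))"
    using hm unfolding harmonically_majorized_on_def by metis
  have "open (K -` ball (K z) d \<inter> S)"
    using continuous_open_preimage[OF holomorphic_on_imp_continuous_on[OF K(1)] S open_ball]
    by (simp add: Int_commute)
  moreover have "z \<in> K -` ball (K z) d \<inter> S" using z g(1) by simp
  ultimately obtain e where e: "e > 0" "ball z e \<subseteq> K -` ball (K z) d \<inter> S"
    unfolding open_contains_ball by blast
  have KB: "u (K y) \<le> Re (g (K y))" if "y \<in> ball z e" for y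
    using e(2) g(3) that by auto
  have "g \<circ> K holomorphic_on ball z e"
    using e by (intro holomorphic_on_compose_gen[OF _ g(2)] holomorphic_on_subset[OF K(1)]) auto
  hence "(\<lambda>y. g (K y) + h y) holomorphic_on ball z e"
    using e by (intro holomorphic_intros holomorphic_on_subset[OF h]) (auto simp: o_def)
  thus "\<exists>d>0. \<exists>g. ball z d \<subseteq> S \<and> g holomorphic_on ball z d \<and>
      (\<forall>y\<in>ball z d. u (K y) + Re (h y) \<le> Re (g y)) \<and> u (K z) + Re (h z) = Re (g z)"
    using e g(4) KB by (intro exI[of _ e] exI[of _ "\<lambda>y. g (K y) + h y"] conjI ballI) auto
qed

section \<open>The potential of a single gap\<close>

text \<open>The substitution s = l sin x, phrased through an antiderivative \<open>G\<close> in x.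
  The derivative of arcsin blows up at the end points, so the fundamental theorem is used with
  continuity on the closed interval and differentiability inside.\<close>

lemma has_integral_arcsin_substitution:
  fixes G :: "real \<Rightarrow> complex"
  assumes l: "l > 0"
    and G: "\<And>x. (G has_vector_derivative of_real (l\<^sup>2 * (cos x)\<^sup>2) * k (l * sin x)) (at x)"
  shows "((\<lambda>s. of_real (sqrt (l\<^sup>2 - s\<^sup>2)) * k s) has_integral G (pi / 2) - G (- pi / 2)) {-l..l}"
proof -
  have contG: "continuous_on UNIV G"
    using G by (auto intro!: continuous_at_imp_continuous_on has_vector_derivative_continuous)
  have "((\<lambda>s. of_real (sqrt (l\<^sup>2 - s\<^sup>2)) * k s) has_integral G (arcsin (l / l)) - G (arcsin (- l / l))) {-l..l}"
  proof (rule fundamental_theorem_of_calculus_interior)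
    show "continuous_on {-l..l} (\<lambda>s. G (arcsin (s / l)))"
      using l by (intro continuous_on_compose2[OF contG] continuous_intros) (auto simp: field_simps)
  next
    fix s assume s: "s \<in> {-l<..<l}"
    define x where "x = arcsin (s / l)"
    have sl: "-1 < s / l" "s / l < 1" using s l by (auto simp: field_simps)
    have sinx: "l * sin x = s" using sl l by (simp add: x_def)
    have cosx: "cos x = sqrt (1 - (s / l)\<^sup>2)" using sl by (simp add: x_def cos_arcsin)
    have "(s / l)\<^sup>2 < 1" using sl by (simp add: abs_square_less_1 abs_less_iff)
    hence cpos: "cos x > 0" by (simp add: cosx)
    have lc: "l * cos x = sqrt (l\<^sup>2 - s\<^sup>2)"
    proof -
      have "l * cos x = sqrt (l\<^sup>2 * (1 - (s / l)\<^sup>2))" using l by (simp add: cosx real_sqrt_mult)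
      thus ?thesis using l by (simp add: right_diff_distrib power_divide)
    qed
    have "((\<lambda>s. arcsin (s / l)) has_vector_derivative (inverse (cos x) / l)) (at s)"
      unfolding has_real_derivative_iff_has_vector_derivative[symmetric]
      using sl l by (auto intro!: derivative_eq_intros simp: cosx field_simps)
    from vector_diff_chain_at[OF this G]
    have "((\<lambda>s. G (arcsin (s / l))) has_vector_derivative
        (inverse (cos x) / l) *\<^sub>R (of_real (l\<^sup>2 * (cos x)\<^sup>2) * k (l * sin x))) (at s)"
      by (simp add: o_def x_def)
    also have "(inverse (cos x) / l) *\<^sub>R (of_real (l\<^sup>2 * (cos x)\<^sup>2) * k (l * sin x))
        = of_real (l * cos x) * k s"
      using cpos l by (simp add: sinx scaleR_conv_of_real field_simps power2_eq_square)
    finally show "((\<lambda>s. G (arcsin (s / l))) has_vector_derivative of_real (sqrt (l\<^sup>2 - s\<^sup>2)) * k s) (at s)"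
      by (simp only: lc)
  qed (use l in simp)
  thus ?thesis using l by simp
qed

lemma integral_semicircle:
  assumes "l > 0"
  shows "((\<lambda>s. complex_of_real (sqrt (l\<^sup>2 - s\<^sup>2))) has_integral of_real (pi * l\<^sup>2 / 2)) {-l..l}"
proof -
  have "((\<lambda>s. of_real (sqrt (l\<^sup>2 - s\<^sup>2)) * (\<lambda>_. 1) s) has_integral
     of_real (l\<^sup>2 * (pi / 2 + sin (pi / 2) * cos (pi / 2)) / 2)
       - complex_of_real (l\<^sup>2 * (- pi / 2 + sin (- pi / 2) * cos (- pi / 2)) / 2)) {-l..l}"
  proof (rule has_integral_arcsin_substitution[OF assms])
    fix x :: real
    have "((\<lambda>x. l\<^sup>2 * (x + sin x * cos x) / 2) has_real_derivative l\<^sup>2 * (cos x)\<^sup>2) (at x)"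
      by (auto intro!: derivative_eq_intros simp: cos_squared_eq) (simp add: field_simps power2_eq_square)
    from has_vector_derivative_of_real[OF this, where 'a = complex]
    show "((\<lambda>x. complex_of_real (l\<^sup>2 * (x + sin x * cos x) / 2)) has_vector_derivative
            of_real (l\<^sup>2 * (cos x)\<^sup>2) * 1) (at x)"
      by (simp only: mult_1_right)
  qed
  thus ?thesis by (simp flip: of_real_diff add: algebra_simps)
qed

text \<open>Explicit antiderivative after s = l sin x. With D = J - i l sin x and R =
  \<open>gap_root l J\<close> one has l^2 cos^2 x = R^2 - (J + i l sin x) D, so the integrand is R^2
  / D - J - i l sin x, and R / D splits into partial fractions in exp (i x).\<close>

lemma has_integral_semicircle_Cauchy:
  assumes l: "l > 0" and J: "Re J > 0"
  shows "((\<lambda>s. of_real (sqrt (l\<^sup>2 - s\<^sup>2)) / (J - \<i> * of_real s)) has_integral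
            of_real pi * (gap_root l J - J)) {-l..l}"
proof -
  define R where "R = gap_root l J"
  have R: "Re R > 0" "R * R = J * J + of_real l * of_real l"
    using gap_root_Re_pos[of J l] J gap_root_square[of l J] by (auto simp: R_def power2_eq_square)
  have "Im (R * R) = Im (J * J)" using R(2) by simp
  hence ImRJ: "Re R * Im R = Re J * Im J" by (simp add: mult.commute)
  have "Im J * Im R \<ge> 0"
  proof -
    have "Re R * (Im J * Im R) = Re J * (Im J)\<^sup>2" using ImRJ by (simp add: power2_eq_square algebra_simps)
    also have "\<dots> \<ge> 0" using J by simp
    finally show ?thesis using R(1) by (simp add: zero_le_mult_iff)
  qed
  hence "Re J * Re R + Im J * Im R > 0" using J R by (simp add: add_pos_nonneg)
  hence "(norm (R - J))\<^sup>2 < (norm (R + J))\<^sup>2"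
    unfolding cmod_power2 by (simp add: power2_eq_square algebra_simps)
  hence lt: "norm (R - J) < norm (R + J)" by (rule power2_less_imp_less) simp
  have prod: "(R + J) * (R - J) = of_real l * of_real l" using R by (simp add: algebra_simps)
  have RJ0: "R + J \<noteq> 0" using J R by (auto simp: complex_eq_iff)
  \<comment> \<open>Chosen so that 2 k D = l (1 - k exp (i x)) (1 + k exp (- i x)) for D = J - i l
    sin x. Since k l = R - J and k (R + J) = l, the inequality |R - J| < |R + J| gives |k| < 1; both
    factors then have positive real part and avoid the cut of \<open>Ln\<close>.\<close>
  define k where "k = of_real l / (R + J)"
  have k0: "k \<noteq> 0" using l RJ0 by (simp add: k_def)
  have kRJ: "k * (R + J) = of_real l" using RJ0 by (simp add: k_def)
  have "(R + J) * (k * of_real l) = (R + J) * (R - J)" using prod kRJ by algebra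
  hence kl: "k * of_real l = R - J" using RJ0 by simp
  have "norm k * norm (k * of_real l) < norm k * norm (k * (R + J)) / norm k * 1"
    using lt k0 kl by (simp add: norm_mult)
  hence "norm k * norm k * l < l" using kRJ k0 l by (simp add: norm_mult)
  hence "norm k * norm k < 1" using l by simp
  hence k1: "norm k < 1" using abs_square_less_1[of "norm k"] by (simp add: power2_eq_square)
  define H where "H = (\<lambda>z. R * (z + \<i> * Ln (1 - k * exp (\<i> * z)) - \<i> * Ln (1 + k * exp (- \<i> * z)))
      - J * z + \<i> * of_real l * cos z)"
  have kl2: "k * (2 * R) = of_real l * (1 + k * k)" "k * (2 * J) = of_real l * (1 - k * k)"
    using kl kRJ by algebra+
  have Re1: "Re (1 + c) > 0" if "norm c < 1" for c :: complex
    using that abs_Re_le_cmod[of c] by simp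
  have "((\<lambda>s. of_real (sqrt (l\<^sup>2 - s\<^sup>2)) * (\<lambda>s. 1 / (J - \<i> * of_real s)) s) has_integral
        (\<lambda>x. H (of_real x)) (pi / 2) - (\<lambda>x. H (of_real x)) (- pi / 2)) {-l..l}"
  proof (rule has_integral_arcsin_substitution[OF l])
    fix x :: real
    define e where "e = exp (\<i> * complex_of_real x)"
    define e' where "e' = exp (- \<i> * complex_of_real x)"
    have ee: "e * e' = 1" by (simp add: e_def e'_def flip: exp_add)
    have ne: "norm e = 1" "norm e' = 1" by (simp_all add: e_def e'_def)
    have R1: "Re (1 - k * e) > 0" "Re (1 + k * e') > 0"
      using Re1[of "- (k * e)"] Re1[of "k * e'"] k1 ne by (simp_all add: norm_mult)
    hence nz: "1 - k * e \<noteq> 0" "1 + k * e' \<noteq> 0" by (metis zero_complex.sel(1) less_irrefl)+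
    have np: "1 - k * e \<notin> \<real>\<^sub>\<le>\<^sub>0" "1 + k * e' \<notin> \<real>\<^sub>\<le>\<^sub>0"
      using R1 unfolding complex_nonpos_Reals_iff by linarith+
    define D where "D = J - \<i> * (of_real l * sin (complex_of_real x))"
    have D0: "D \<noteq> 0" using J by (auto simp: D_def complex_eq_iff sin_of_real)
    have sinx: "2 * \<i> * sin (complex_of_real x) = e - e'"
      by (simp add: sin_exp_eq e_def e'_def)
    have Dk: "2 * k * D = of_real l * ((1 - k * e) * (1 + k * e'))"
      using kl2(2) sinx ee unfolding D_def by algebra
    have "(H has_field_derivative R * (1 + k * e / (1 - k * e) - k * e' / (1 + k * e'))
        - J - \<i> * of_real l * sin (of_real x)) (at (of_real x))"
      unfolding H_def
      using np nz by (auto intro!: derivative_eq_intros simp: e_def e'_def algebra_simps divide_inverse)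
    also have "R * (1 + k * e / (1 - k * e) - k * e' / (1 + k * e')) = R * R / D"
    proof -
      have "1 + k * e / (1 - k * e) - k * e' / (1 + k * e')
          = (1 + k * k) / ((1 - k * e) * (1 + k * e'))"
        using nz ee by (simp add: divide_simps) algebra
      also have "\<dots> = R / D"
        using Dk kl2(1) nz D0 k0 l by (simp add: frac_eq_eq) algebra
      finally show ?thesis by simp
    qed
    also have "R * R / D - J - \<i> * of_real l * sin (of_real x)
        = of_real (l\<^sup>2 * (cos x)\<^sup>2) * (1 / (J - \<i> * of_real (l * sin x)))"
    proof -
      have cs: "(cos (complex_of_real x))\<^sup>2 = 1 - (sin (complex_of_real x))\<^sup>2" by (rule cos_squared_eq)
      have "R * R / D - J - \<i> * of_real l * sin (of_real x)
          = (R * R - (J + \<i> * of_real l * sin (of_real x)) * D) / D"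
        using D0 by (simp add: field_simps)
      also have "R * R - (J + \<i> * of_real l * sin (of_real x)) * D
          = (of_real l)\<^sup>2 * (cos (of_real x))\<^sup>2"
        unfolding cs D_def R(2) by (simp add: power2_eq_square algebra_simps)
      finally show ?thesis by (simp add: D_def cos_of_real sin_of_real)
    qed
    finally show "((\<lambda>x. H (of_real x)) has_vector_derivative
        of_real (l\<^sup>2 * (cos x)\<^sup>2) * (1 / (J - \<i> * of_real (l * sin x)))) (at x)"
      by (rule has_vector_derivative_real_field)
  qed
  \<comment> \<open>At both ends exp (- i x) = - exp (i x): the two logarithms cancel, the cosine
    vanishes, and only (R - J) x remains.\<close>
  also have "(\<lambda>x. H (of_real x)) (pi / 2) - (\<lambda>x. H (of_real x)) (- pi / 2) = of_real pi * (R - J)"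
  proof -
    have e: "exp (\<i> * complex_of_real (pi / 2)) = \<i>"
      by (simp only: cis_conv_exp[symmetric] cis_pi_half)
    have "exp (\<i> * complex_of_real (- (pi / 2))) = - \<i>"
      by (simp only: cis_conv_exp[symmetric] cis_minus_pi_half)
    hence e': "exp (- \<i> * complex_of_real (pi / 2)) = - \<i>" by simp
    have c: "cos (complex_of_real (pi / 2)) = 0" "cos (complex_of_real (- pi / 2)) = 0"
      by (simp_all flip: cos_of_real)
    have e2: "exp (\<i> * complex_of_real (- pi / 2)) = - \<i>" "exp (- \<i> * complex_of_real (- pi / 2)) = \<i>"
      using e e' by simp_all
    have "H (of_real (pi / 2)) = R * of_real (pi / 2) - J * of_real (pi / 2)"
      unfolding H_def e e' c by simp
    moreover have "H (of_real (- pi / 2)) = R * of_real (- pi / 2) - J * of_real (- pi / 2)"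
      unfolding H_def e2 c by simp
    ultimately have "(\<lambda>x. H (of_real x)) (pi / 2) - (\<lambda>x. H (of_real x)) (- pi / 2)
        = R * of_real (pi / 2) - J * of_real (pi / 2) - (R * of_real (- pi / 2) - J * of_real (- pi / 2))"
      by (simp only:)
    also have "\<dots> = of_real pi * (R - J)" by (simp add: field_simps)
    finally show ?thesis .
  qed
  finally show ?thesis by (simp add: R_def)
qed

section \<open>The Poisson representation of the one-gap function\<close>

definition gap_map :: "real \<Rightarrow> complex \<Rightarrow> complex" where
  "gap_map l J = (J + gap_root l J) / 2"

text \<open>Serves both half-planes at once; the factor 1 / pi is kept in the densities. For x = 0
  the value is 0, so the imaginary axis is treated separately.\<close>

definition Poisson_kernel :: "real \<Rightarrow> real \<Rightarrow> real" where
  "Poisson_kernel x y = \<bar>x\<bar> / (x\<^sup>2 + y\<^sup>2)"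

lemma Poisson_kernel_nonneg: "Poisson_kernel x y \<ge> 0"
  by (simp add: Poisson_kernel_def)

lemma borel_measurable_Poisson_kernel [measurable]:
  "Poisson_kernel x \<in> borel_measurable borel"
  unfolding Poisson_kernel_def by measurable

lemma Poisson_kernel_le: "Poisson_kernel x y \<le> 1 / \<bar>x\<bar>"
proof (cases "x = 0")
  case False
  hence "\<bar>x\<bar> * \<bar>x\<bar> \<le> x\<^sup>2 + y\<^sup>2" "x\<^sup>2 + y\<^sup>2 > 0"
    by (simp_all add: sum_power2_gt_zero_iff) (simp add: power2_eq_square flip: abs_mult)
  thus ?thesis using False by (simp add: Poisson_kernel_def divide_simps)
qed (simp add: Poisson_kernel_def)

lemma Poisson_kernel_le':
  assumes "\<bar>y\<bar> \<ge> d" "d > 0"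
  shows "Poisson_kernel x y \<le> \<bar>x\<bar> / d\<^sup>2"
proof -
  have "d\<^sup>2 \<le> x\<^sup>2 + y\<^sup>2" using power_mono[OF assms(1), of 2] assms(2) by (simp add: add_increasing)
  moreover have "d\<^sup>2 > 0" using assms(2) by simp
  moreover from calculation have "x\<^sup>2 + y\<^sup>2 > 0" by linarith
  ultimately show ?thesis unfolding Poisson_kernel_def
    by (intro divide_left_mono mult_pos_pos) auto
qed

lemma Poisson_kernel_antimono:
  assumes "\<bar>a\<bar> \<le> \<bar>b\<bar>" "x \<noteq> 0"
  shows "Poisson_kernel x b \<le> Poisson_kernel x a"
proof -
  have "a\<^sup>2 \<le> b\<^sup>2" using assms by (simp add: abs_le_square_iff)
  moreover have "x\<^sup>2 > 0" using assms by simp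
  ultimately show ?thesis unfolding Poisson_kernel_def
    by (intro divide_left_mono) (auto intro!: mult_pos_pos add_pos_nonneg)
qed

lemma Re_divide_Poisson_kernel:
  "Re (of_real c / (J - \<i> * of_real s)) = sgn (Re J) * (c * Poisson_kernel (Re J) (Im J - s))"
  by (simp add: Re_divide Poisson_kernel_def sgn_if)

lemma gap_root_reflect:
  assumes "Re J \<noteq> 0 \<or> \<bar>Im J\<bar> < l"
  shows "gap_root l (- cnj J) = cnj (gap_root l J)"
proof -
  have "(gap_root l (- cnj J))\<^sup>2 = (cnj (gap_root l J))\<^sup>2"
    by (simp add: gap_root_square del: of_real_power flip: complex_cnj_power)
  hence "gap_root l (- cnj J) = cnj (gap_root l J) \<or> gap_root l (- cnj J) = - cnj (gap_root l J)"
    by (simp add: power2_eq_iff)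
  moreover have "Re (gap_root l (- cnj J)) > 0" "Re (gap_root l J) > 0"
    using assms by (auto intro!: gap_root_Re_pos)
  ultimately show ?thesis by auto
qed

text \<open>In the right half-plane this is the real part of the Cauchy integral divided by 2 pi.
  The reflection J \<mapsto> - cnj J conjugates the root and carries the formula to the left
  half-plane, where the subtracted term becomes 0.\<close>

lemma set_integral_semicircle_Poisson:
  assumes l: "l > 0" and J: "Re J \<noteq> 0"
  shows "(LINT s:{-l..l}|lborel. sqrt (l\<^sup>2 - s\<^sup>2) / (2 * pi) * Poisson_kernel (Re J) (Im J - s))
       = Re (gap_map l J) - max 0 (Re J)"
proof -
  have pos: "(LINT s:{-l..l}|lborel. sqrt (l\<^sup>2 - s\<^sup>2) / (2 * pi) * Poisson_kernel (Re J) (Im J - s))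
       = Re (gap_map l J) - Re J" if J: "Re J > 0" for J
  proof -
    have "((\<lambda>s. Re (of_real (sqrt (l\<^sup>2 - s\<^sup>2)) / (J - \<i> * of_real s))) has_integral
            Re (of_real pi * (gap_root l J - J))) {-l..l}"
      by (intro has_integral_Re has_integral_semicircle_Cauchy l J)
    from has_integral_divide[OF this, of "2 * pi"]
    have hi: "((\<lambda>s. sqrt (l\<^sup>2 - s\<^sup>2) / (2 * pi) * Poisson_kernel (Re J) (Im J - s)) has_integral
            Re (gap_map l J) - Re J) {-l..l}"
      unfolding Re_divide_Poisson_kernel using J
      by (simp add: gap_map_def mult_ac flip: right_diff_distrib)
    have si: "set_integrable lborel {-l..l} (\<lambda>s. sqrt (l\<^sup>2 - s\<^sup>2) / (2 * pi) * Poisson_kernel (Re J) (Im J - s))"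
    proof (rule borel_integrable_atLeastAtMost')
      have "(Re J)\<^sup>2 + (Im J - s)\<^sup>2 \<noteq> 0" for s using J by (simp add: add_pos_nonneg less_imp_neq[symmetric])
      thus "continuous_on {- l..l} (\<lambda>s. sqrt (l\<^sup>2 - s\<^sup>2) / (2 * pi) * Poisson_kernel (Re J) (Im J - s))"
        unfolding Poisson_kernel_def by (intro continuous_intros) auto
    qed
    show ?thesis
      using set_borel_integral_eq_integral(2)[OF si] integral_unique[OF hi] by (simp only:)
  qed
  show ?thesis
  proof (cases "Re J > 0")
    case True
    thus ?thesis using pos[OF True] by simp
  next
    case False
    hence "Re (- cnj J) > 0" using J by simp
    from pos[OF this] gap_root_reflect[of J l] J False show ?thesis
      by (simp add: gap_map_def Poisson_kernel_def field_simps)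
  qed
qed

lemma Re_gap_map_imaginary: "\<bar>y\<bar> \<le> l \<Longrightarrow> Re (gap_map l (Complex 0 y)) = sqrt (l\<^sup>2 - y\<^sup>2) / 2"
proof -
  assume "\<bar>y\<bar> \<le> l"
  hence "y\<^sup>2 \<le> l\<^sup>2" by (simp add: abs_le_square_iff[symmetric])
  moreover have "(Complex 0 y)\<^sup>2 + of_real (l\<^sup>2) = of_real (l\<^sup>2 - y\<^sup>2)"
    by (simp add: complex_eq_iff power2_eq_square)
  ultimately show ?thesis
    by (simp add: gap_map_def gap_root_def csqrt_of_real_nonneg del: of_real_diff of_real_power)
qed

section \<open>The potential of several gaps\<close>

context
  fixes U :: "real set" and l B :: real
  assumes open_U: "open U" and U_bounded: "U \<subseteq> {-B..B}" and l_pos: "l > 0"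
    and emeasure_U: "emeasure lborel U = ennreal (2 * l)"
begin

text \<open>Squeezes the complement of \<open>U\<close> out of the line, moving the components of
  \<open>U\<close> together to fill the interval from -l to l. It is monotone, 1-Lipschitz and a
  translation on each component; these facts carry the comparison with a single gap.\<close>

definition collapse :: "real \<Rightarrow> real" where
  "collapse s = measure lborel (U \<inter> {..s}) - l"

lemma sets_U [measurable]: "U \<in> sets borel"
  using open_U by simp

lemma emeasure_U_Int_finite: "emeasure lborel (U \<inter> A) < \<infinity>"
proof -
  have "emeasure lborel (U \<inter> A) \<le> emeasure lborel U" by (intro emeasure_mono) auto
  thus ?thesis by (simp add: emeasure_U le_less_trans)
qed

lemma collapse_diff:
  assumes "a \<le> b"
  shows "collapse b - collapse a = measure lborel (U \<inter> {a<..b})"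
proof -
  have "U \<inter> {..b} = (U \<inter> {..a}) \<union> (U \<inter> {a<..b})" using assms by auto
  moreover have "measure lborel ((U \<inter> {..a}) \<union> (U \<inter> {a<..b}))
      = measure lborel (U \<inter> {..a}) + measure lborel (U \<inter> {a<..b})"
    using emeasure_U_Int_finite by (intro measure_Union) (auto simp: less_top)
  ultimately show ?thesis by (simp add: collapse_def)
qed

lemma collapse_mono: "a \<le> b \<Longrightarrow> collapse a \<le> collapse b"
  using collapse_diff[of a b] measure_nonneg[of lborel "U \<inter> {a<..b}"] by linarith

lemma collapse_Lipschitz: "\<bar>collapse a - collapse b\<bar> \<le> \<bar>a - b\<bar>"
proof (induction a b rule: linorder_wlog)
  case (le a b)
  have "measure lborel (U \<inter> {a<..b}) \<le> measure lborel {a<..b}"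
    by (intro measure_mono_fmeasurable) (use le in \<open>auto simp: fmeasurable_def\<close>)
  thus ?case using collapse_diff[OF le] collapse_mono[OF le] le by simp
qed (simp add: abs_minus_commute)

lemma collapse_translation:
  assumes "a \<le> b" "{a<..b} \<subseteq> U"
  shows "collapse b - collapse a = b - a"
proof -
  have "U \<inter> {a<..b} = {a<..b}" using assms by auto
  thus ?thesis using collapse_diff[OF assms(1)] assms(1) by simp
qed

lemma continuous_on_collapse: "continuous_on A collapse"
proof (rule continuous_on_subset)
  show "continuous_on UNIV collapse"
    unfolding continuous_on_iff dist_real_def using collapse_Lipschitz by (meson le_less_trans)
qed auto

lemma borel_measurable_collapse [measurable]: "collapse \<in> borel_measurable borel"
  by (rule borel_measurable_continuous_onI[OF continuous_on_collapse])

lemma collapse_below: "s < - B \<Longrightarrow> collapse s = - l"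
  using U_bounded by (subst collapse_def, subst Int_emptyI) auto

lemma collapse_above: "s \<ge> B \<Longrightarrow> collapse s = l"
proof -
  assume "s \<ge> B"
  hence "U \<inter> {..s} = U" using U_bounded by fastforce
  thus ?thesis using emeasure_U l_pos by (simp add: collapse_def measure_def)
qed

lemma abs_collapse_le: "\<bar>collapse s\<bar> \<le> l"
proof -
  have "- l \<le> collapse s" by (simp add: collapse_def)
  moreover have "collapse s \<le> collapse (max s B)" by (rule collapse_mono) simp
  ultimately show ?thesis using collapse_above[of "max s B"] by simp
qed

lemma collapse_strict:
  assumes "s \<in> U"
  shows "a < s \<Longrightarrow> collapse a < collapse s" and "s < b \<Longrightarrow> collapse s < collapse b"
proof -
  obtain d where d: "d > 0" "\<And>x. \<bar>x - s\<bar> < d \<Longrightarrow> x \<in> U"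
    using open_U assms unfolding open_dist dist_real_def by metis
  {
    assume "a < s"
    hence "collapse s - collapse (max a (s - d / 2)) = s - max a (s - d / 2)"
      using d by (intro collapse_translation) auto
    thus "collapse a < collapse s"
      using collapse_mono[of a "max a (s - d / 2)"] \<open>a < s\<close> d(1) by linarith
  next
    assume "s < b"
    hence "collapse (min b (s + d / 2)) - collapse s = min b (s + d / 2) - s"
      using d by (intro collapse_translation) auto
    thus "collapse s < collapse b"
      using collapse_mono[of "min b (s + d / 2)" b] \<open>s < b\<close> d(1) by linarith
  }
qed

lemma abs_collapse_less: "s \<in> U \<Longrightarrow> \<bar>collapse s\<bar> < l"
  using collapse_strict(1)[of s "s - 1"] collapse_strict(2)[of s "s + 1"] abs_collapse_le[of "s - 1"] abs_collapse_le[of "s + 1"]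
  by (simp add: abs_le_iff abs_less_iff)

text \<open>In the main case the intermediate value theorem gives c with
  \<open>collapse c = a\<close>. At points of the open set \<open>U\<close> the map is strictly
  increasing, so the part of \<open>U\<close> above level a is the part beyond c, of length l -
  a.\<close>

lemma emeasure_collapse_greater:
  "emeasure lborel (U \<inter> {s. a < collapse s}) = emeasure lborel ({-l..l} \<inter> {a<..})"
proof -
  consider "a < - l" | "a \<ge> l" | "- l \<le> a" "a < l" by linarith
  thus ?thesis
  proof cases
    case 1
    hence "a < collapse s" for s using abs_collapse_le[of s] by linarith
    hence "U \<inter> {s. a < collapse s} = U" by auto
    moreover have "{-l..l} \<inter> {a<..} = {-l..l}" using 1 by auto
    ultimately show ?thesis using l_pos by (simp add: emeasure_U)
  next
    case 2
    hence "\<not> a < collapse s" for s using abs_collapse_le[of s] by linarith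
    hence "U \<inter> {s. a < collapse s} = {}" by auto
    moreover have "{-l..l} \<inter> {a<..} = {}" using 2 by auto
    ultimately show ?thesis by simp
  next
    case 3
    \<comment> \<open>The extra 1 provides the strict inequality - b < - B that
      \<open>collapse_below\<close> asks for.\<close>
    define b where "b = \<bar>B\<bar> + 1"
    have "\<exists>x\<ge>-b. x \<le> b \<and> collapse x = a"
      using 3 collapse_below[of "-b"] collapse_above[of b]
      by (intro IVT' continuous_on_collapse) (auto simp: b_def)
    then obtain c where c: "collapse c = a" by blast
    have "U \<inter> {s. a < collapse s} = U - {..c}"
    proof (intro equalityI subsetI)
      fix s assume "s \<in> U \<inter> {s. a < collapse s}"
      thus "s \<in> U - {..c}" using collapse_mono[of s c] c by auto
    next
      fix s assume "s \<in> U - {..c}"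
      thus "s \<in> U \<inter> {s. a < collapse s}" using collapse_strict(1)[of s c] c by auto
    qed
    also have "U - {..c} = U - (U \<inter> {..c})" by auto
    also have "emeasure lborel \<dots> = emeasure lborel U - emeasure lborel (U \<inter> {..c})"
      using emeasure_U_Int_finite[of "{..c}"] by (intro emeasure_Diff) (auto simp: less_top)
    also have "emeasure lborel (U \<inter> {..c}) = ennreal (a + l)"
      using c emeasure_U_Int_finite[of "{..c}"]
      by (subst emeasure_eq_ennreal_measure) (auto simp: less_top collapse_def)
    also have "emeasure lborel U - ennreal (a + l) = ennreal (l - a)"
      using 3 by (simp add: emeasure_U ennreal_minus)
    also have "{-l..l} \<inter> {a<..} = {a<..l}" using 3 by auto
    hence "ennreal (l - a) = emeasure lborel ({-l..l} \<inter> {a<..})" using 3 by simp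
    finally show ?thesis .
  qed
qed

text \<open>Measures finite on the rays to the right and equal on them coincide, so the preceding
  lemma suffices. This change of variables turns integrals over \<open>U\<close> into integrals over
  one gap.\<close>

lemma distr_collapse:
  "distr (density lborel (indicator U)) borel collapse = density lborel (indicator {-l..l})"
proof (rule measure_eqI_lessThan)
  fix a :: real
  have *: "emeasure (density lborel (indicator A)) C = emeasure lborel (A \<inter> C)"
    if "A \<in> sets borel" "C \<in> sets borel" for A C :: "real set"
    using that by (simp add: emeasure_density nn_integral_indicator flip: indicator_inter_arith)
  have "emeasure (distr (density lborel (indicator U)) borel collapse) {a<..}
      = emeasure lborel (U \<inter> {s. a < collapse s})"
    by (subst emeasure_distr) (auto simp: * vimage_def)
  also have "\<dots> = emeasure lborel ({-l..l} \<inter> {a<..})" by (rule emeasure_collapse_greater)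
  also have "\<dots> = emeasure (density lborel (indicator {-l..l})) {a<..}" by (simp add: *)
  finally show "emeasure (distr (density lborel (indicator U)) borel collapse) {a<..}
      = emeasure (density lborel (indicator {-l..l})) {a<..}" .
  have "emeasure lborel (U \<inter> {s. a < collapse s}) < \<infinity>" by (rule emeasure_U_Int_finite)
  thus "emeasure (distr (density lborel (indicator U)) borel collapse) {a<..} < \<infinity>"
    by (subst emeasure_distr) (auto simp: * vimage_def)
qed auto

lemma set_integral_collapse:
  fixes g :: "real \<Rightarrow> real"
  assumes [measurable]: "g \<in> borel_measurable borel"
  shows "(LINT s:U|lborel. g (collapse s)) = (LINT s:{-l..l}|lborel. g s)"
proof -
  have dens: "integral\<^sup>L (density lborel (indicator A)) h = (LINT s:A|lborel. h s)"
    if [measurable]: "A \<in> sets borel" "h \<in> borel_measurable borel" for A and h :: "real \<Rightarrow> real"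
    unfolding set_lebesgue_integral_def
    using integral_density[where f = h and g = "indicator A" and M = lborel] by (simp add: ennreal_indicator)
  have "(LINT s:U|lborel. g (collapse s)) = integral\<^sup>L (density lborel (indicator U)) (\<lambda>s. g (collapse s))"
    by (subst dens) auto
  also have "\<dots> = integral\<^sup>L (distr (density lborel (indicator U)) borel collapse) g"
    by (subst integral_distr) auto
  also have "\<dots> = (LINT s:{-l..l}|lborel. g s)"
    unfolding distr_collapse by (subst dens) auto
  finally show ?thesis .
qed

text \<open>The boundary value sqrt (l^2 - y^2) / 2 of the one-gap function at y =
  \<open>collapse s\<close>, divided by the pi of the Poisson kernel. It need not vanish off
  \<open>U\<close>, so all integrals are taken over \<open>U\<close>.\<close>

definition gap_density :: "real \<Rightarrow> real" where
  "gap_density s = sqrt (l\<^sup>2 - (collapse s)\<^sup>2) / (2 * pi)"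

lemma gap_density_nonneg: "gap_density s \<ge> 0"
proof -
  have "(collapse s)\<^sup>2 \<le> l\<^sup>2" using abs_collapse_le[of s] by (simp add: abs_le_square_iff[symmetric])
  thus ?thesis by (simp add: gap_density_def)
qed

lemma gap_density_le: "gap_density s \<le> l"
proof -
  have "sqrt (l\<^sup>2 - (collapse s)\<^sup>2) \<le> sqrt (l\<^sup>2)" by (intro real_sqrt_le_mono) simp
  also have "\<dots> = l" using l_pos by simp
  also have "l * 1 \<le> l * (2 * pi)" using l_pos pi_gt3 by (intro mult_left_mono) auto
  finally show ?thesis unfolding gap_density_def by (simp add: divide_simps mult_ac)
qed

lemma borel_measurable_gap_density [measurable]: "gap_density \<in> borel_measurable borel"
  unfolding gap_density_def by measurable

lemma set_integrable_bounded:
  fixes h :: "real \<Rightarrow> 'b::{banach, second_countable_topology}"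
  assumes [measurable]: "h \<in> borel_measurable borel" and bd: "\<And>s. s \<in> U \<Longrightarrow> norm (h s) \<le> C"
  shows "set_integrable lborel U h"
proof -
  have "set_integrable lborel U (\<lambda>_. C)"
    unfolding set_integrable_def using emeasure_U by (intro integrable_scaleR_left) (auto simp: integrable_indicator_iff)
  thus ?thesis
    unfolding set_integrable_def
    by (rule Bochner_Integration.integrable_bound) (use bd in \<open>auto simp: indicator_def intro!: AE_I2 order_trans[OF bd]\<close>)
qed

lemma norm_set_integral_le:
  fixes h :: "real \<Rightarrow> 'b::{banach, second_countable_topology}"
  assumes [measurable]: "h \<in> borel_measurable borel" and bd: "\<And>s. s \<in> U \<Longrightarrow> norm (h s) \<le> C" and "C \<ge> 0"
  shows "norm (LINT s:U|lborel. h s) \<le> 2 * l * C"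
proof -
  have "norm (LINT s:U|lborel. h s) \<le> (LINT s:U|lborel. norm (h s))"
    by (rule set_integral_norm_bound[OF set_integrable_bounded[OF assms(1,2)]])
  also have "\<dots> \<le> (LINT s:U|lborel. C)"
    by (intro set_integral_mono set_integrable_bounded[where C = C]) (use bd assms(3) in auto)
  also have "\<dots> = 2 * l * C"
    using emeasure_U l_pos by (simp add: set_lebesgue_integral_def measure_def)
  finally show ?thesis .
qed

text \<open>The kernel vanishes for Re J = 0, so the boundary value of the Poisson integral is
  prescribed there; at points of \<open>U\<close> this makes the two half-planes fit together
  continuously.\<close>

definition gap_potential :: "complex \<Rightarrow> real" where
  "gap_potential J = (if Re J = 0 then sqrt (l\<^sup>2 - (collapse (Im J))\<^sup>2) / 2
     else max 0 (Re J) + (LINT s:U|lborel. gap_density s * Poisson_kernel (Re J) (Im J - s)))"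

definition collapsed_point :: "complex \<Rightarrow> complex" where
  "collapsed_point J = Complex (Re J) (collapse (Im J))"

lemma gap_potential_ge: "gap_potential J \<ge> max 0 (Re J)"
proof (cases "Re J = 0")
  case True
  have "(collapse (Im J))\<^sup>2 \<le> l\<^sup>2" using abs_collapse_le[of "Im J"] by (simp add: abs_le_square_iff[symmetric])
  thus ?thesis using True by (simp add: gap_potential_def)
next
  case False
  have "(LINT s:U|lborel. gap_density s * Poisson_kernel (Re J) (Im J - s)) \<ge> 0"
    unfolding set_lebesgue_integral_def
    by (intro integral_nonneg_AE AE_I2) (simp add: gap_density_nonneg Poisson_kernel_nonneg)
  thus ?thesis using False by (simp add: gap_potential_def)
qed

lemma set_integrable_gap_density_Poisson:
  assumes "x \<noteq> 0" and [measurable]: "h \<in> borel_measurable borel"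
  shows "set_integrable lborel U (\<lambda>s. gap_density s * Poisson_kernel x (h s))"
proof (rule set_integrable_bounded)
  show "norm (gap_density s * Poisson_kernel x (h s)) \<le> l * (1 / \<bar>x\<bar>)" for s
    using gap_density_nonneg Poisson_kernel_nonneg l_pos
    unfolding real_norm_def abs_mult
    by (intro mult_mono) (simp_all add: gap_density_le Poisson_kernel_le del: mult_1_right)
qed measurable

text \<open>The one-gap formula after the change of variables. Against \<open>gap_potential\<close>
  only the second argument of the kernel differs: a difference of collapsed points in place of a
  difference of points.\<close>

lemma Re_gap_map_collapsed_point:
  assumes "Re J \<noteq> 0"
  shows "Re (gap_map l (collapsed_point J)) = max 0 (Re J) +
     (LINT s:U|lborel. gap_density s * Poisson_kernel (Re J) (collapse (Im J) - collapse s))"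
proof -
  have "(LINT s:U|lborel. gap_density s * Poisson_kernel (Re J) (collapse (Im J) - collapse s))
    = (LINT s:{-l..l}|lborel. sqrt (l\<^sup>2 - s\<^sup>2) / (2 * pi) * Poisson_kernel (Re J) (collapse (Im J) - s))"
    unfolding gap_density_def
    by (rule set_integral_collapse[of "\<lambda>s. sqrt (l\<^sup>2 - s\<^sup>2) / (2 * pi) * Poisson_kernel (Re J) (collapse (Im J) - s)"]) measurable
  thus ?thesis
    using set_integral_semicircle_Poisson[OF l_pos, of "collapsed_point J"] assms
    by (simp add: collapsed_point_def)
qed

lemma gap_potential_imaginary:
  "Re J = 0 \<Longrightarrow> gap_potential J = Re (gap_map l (collapsed_point J))"
  using abs_collapse_le[of "Im J"] by (simp add: gap_potential_def collapsed_point_def Re_gap_map_imaginary)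

text \<open>Since \<open>collapse\<close> does not increase distances, it only increases the Poisson kernel.\<close>

lemma gap_potential_le: "gap_potential J \<le> Re (gap_map l (collapsed_point J))"
proof (cases "Re J = 0")
  case False
  have "(LINT s:U|lborel. gap_density s * Poisson_kernel (Re J) (Im J - s))
     \<le> (LINT s:U|lborel. gap_density s * Poisson_kernel (Re J) (collapse (Im J) - collapse s))"
    using False collapse_Lipschitz
    by (intro set_integral_mono set_integrable_gap_density_Poisson mult_left_mono
          Poisson_kernel_antimono gap_density_nonneg) auto
  thus ?thesis using False by (simp add: gap_potential_def Re_gap_map_collapsed_point)
qed (simp add: gap_potential_imaginary)

section \<open>The Cauchy transform of the transported density\<close>

definition gap_transform :: "complex \<Rightarrow> complex" where
  "gap_transform J = (LINT s:U|lborel. of_real (gap_density s) / (J - \<i> * of_real s))"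

lemma norm_diff_imaginary_ge: "norm (J - \<i> * of_real s) \<ge> \<bar>Re J\<bar>"
  using abs_Re_le_cmod[of "J - \<i> * of_real s"] by simp

lemma set_integrable_gap_transform:
  assumes "Re J \<noteq> 0"
  shows "set_integrable lborel U (\<lambda>s. of_real (gap_density s) / (J - \<i> * of_real s))"
proof (rule set_integrable_bounded)
  show "norm (of_real (gap_density s) / (J - \<i> * of_real s)) \<le> l / \<bar>Re J\<bar>" for s
    unfolding norm_divide using assms gap_density_nonneg gap_density_le l_pos
    by (intro frac_le norm_diff_imaginary_ge) auto
qed measurable

lemma gap_potential_gap_transform:
  assumes "Re J \<noteq> 0"
  shows "gap_potential J = max 0 (Re J) + sgn (Re J) * Re (gap_transform J)"
proof -
  have "Re (gap_transform J) = (LINT s:U|lborel. Re (of_real (gap_density s) / (J - \<i> * of_real s)))"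
    using set_integrable_gap_transform[OF assms]
    unfolding gap_transform_def set_lebesgue_integral_def set_integrable_def
    by (subst integral_Re[symmetric]) auto
  also have "\<dots> = sgn (Re J) * (LINT s:U|lborel. gap_density s * Poisson_kernel (Re J) (Im J - s))"
    unfolding Re_divide_Poisson_kernel by simp
  finally have "sgn (Re J) * Re (gap_transform J) =
      (sgn (Re J) * sgn (Re J)) * (LINT s:U|lborel. gap_density s * Poisson_kernel (Re J) (Im J - s))"
    by simp
  moreover have "sgn (Re J) * sgn (Re J) = 1" using assms by (simp add: sgn_if)
  ultimately show ?thesis using assms by (simp add: gap_potential_def)
qed

lemma gap_transform_has_field_derivative:
  assumes J: "Re J \<noteq> 0"
  shows "(gap_transform has_field_derivative
            - (LINT s:U|lborel. of_real (gap_density s) / (J - \<i> * of_real s)\<^sup>2)) (at J)"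
proof -
  define x where "x = \<bar>Re J\<bar>"
  have x: "x > 0" using J by (simp add: x_def)
  define D where "D = - (LINT s:U|lborel. of_real (gap_density s) / (J - \<i> * of_real s)\<^sup>2)"
  have int2: "set_integrable lborel U (\<lambda>s. of_real (gap_density s) / (J - \<i> * of_real s)\<^sup>2)"
  proof (rule set_integrable_bounded)
    show "norm (of_real (gap_density s) / (J - \<i> * of_real s)\<^sup>2) \<le> l / x\<^sup>2" for s
      unfolding norm_divide norm_power x_def using J gap_density_nonneg gap_density_le l_pos
      by (intro frac_le power_mono norm_diff_imaginary_ge) auto
  qed measurable
  define C where "C = 2 * l * (l / (x / 2 * x\<^sup>2))"
  have bound: "norm ((gap_transform (J + h) - gap_transform J) / h - D) \<le> C * norm h"
    if h: "h \<noteq> 0" "norm h < x / 2" for h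
  proof -
    have "\<bar>Re J\<bar> \<le> \<bar>Re J + Re h\<bar> + \<bar>Re h\<bar>" by linarith
    hence R: "\<bar>Re (J + h)\<bar> \<ge> x / 2" using h(2) abs_Re_le_cmod[of h] by (simp add: x_def)
    hence R0: "Re (J + h) \<noteq> 0" using x by auto
    have nz: "J + h - \<i> * of_real s \<noteq> 0" "J - \<i> * of_real s \<noteq> 0" for s
      using R0 J by (auto simp: complex_eq_iff)
    \<comment> \<open>The exact second-order remainder of 1 / (J - i s). Integrated, it makes the
      error of the difference quotient h times an integral that stays bounded for |h| < x /
      2.\<close>
    have eq: "of_real (gap_density s) / (J + h - \<i> * of_real s) - of_real (gap_density s) / (J - \<i> * of_real s)
          + h * (of_real (gap_density s) / (J - \<i> * of_real s)\<^sup>2)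
        = h\<^sup>2 * (of_real (gap_density s) / ((J + h - \<i> * of_real s) * (J - \<i> * of_real s)\<^sup>2))" for s
      using nz[of s] by (simp add: divide_simps power2_eq_square) (simp add: algebra_simps)
    have "gap_transform (J + h) - gap_transform J - h * D
        = (LINT s:U|lborel. of_real (gap_density s) / (J + h - \<i> * of_real s) - of_real (gap_density s) / (J - \<i> * of_real s)
          + h * (of_real (gap_density s) / (J - \<i> * of_real s)\<^sup>2))"
      unfolding gap_transform_def D_def
      using set_integrable_gap_transform[OF R0] set_integrable_gap_transform[OF J] int2
      by (simp add: set_integral_diff set_integral_add del: times_divide_eq_right times_divide_eq_left)
    also have "\<dots> = h\<^sup>2 * (LINT s:U|lborel. of_real (gap_density s) / ((J + h - \<i> * of_real s) * (J - \<i> * of_real s)\<^sup>2))"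
      unfolding eq by (rule set_integral_mult_right)
    finally have diff: "(gap_transform (J + h) - gap_transform J) / h - D
        = h * (LINT s:U|lborel. of_real (gap_density s) / ((J + h - \<i> * of_real s) * (J - \<i> * of_real s)\<^sup>2))"
      using h(1) by (simp add: field_simps power2_eq_square)
    have "norm (LINT s:U|lborel. of_real (gap_density s) / ((J + h - \<i> * of_real s) * (J - \<i> * of_real s)\<^sup>2)) \<le> C"
      unfolding C_def
    proof (rule norm_set_integral_le)
      show "norm (of_real (gap_density s) / ((J + h - \<i> * of_real s) * (J - \<i> * of_real s)\<^sup>2)) \<le> l / (x / 2 * x\<^sup>2)" for s
        unfolding norm_divide norm_power norm_mult
        using x gap_density_nonneg gap_density_le l_pos R norm_diff_imaginary_ge[of "J + h" s] norm_diff_imaginary_ge[of J s]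
        by (intro frac_le mult_mono power_mono) (auto simp: x_def)
    qed (use x l_pos in auto)
    from mult_right_mono[OF this norm_ge_zero[of h]] show ?thesis
      unfolding diff norm_mult by (simp only: mult.commute)
  qed
  have "((\<lambda>h. (gap_transform (J + h) - gap_transform J) / h - D) \<longlongrightarrow> 0) (at 0)"
  proof (rule Lim_null_comparison)
    have "eventually (\<lambda>h::complex. h \<in> ball 0 (x / 2) - {0}) (at 0)"
      using x eventually_at_ball'[of "x / 2" "0::complex" UNIV] by (auto elim: eventually_mono)
    thus "eventually (\<lambda>h. norm ((gap_transform (J + h) - gap_transform J) / h - D) \<le> C * norm h) (at 0)"
      by eventually_elim (use bound in auto)
    show "((\<lambda>h::complex. C * norm h) \<longlongrightarrow> 0) (at 0)"
      by (intro tendsto_mult_right_zero tendsto_norm_zero tendsto_ident_at)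
  qed
  thus ?thesis unfolding DERIV_def D_def[symmetric] by (subst LIM_zero_iff[symmetric])
qed

lemma holomorphic_on_gap_transform: "gap_transform holomorphic_on {J. Re J \<noteq> 0}"
  unfolding holomorphic_on_def
  using gap_transform_has_field_derivative
  by (auto intro: has_field_derivative_at_within simp: field_differentiable_def)

text \<open>The limit is the total mass of the density, after the change of variables that of the
  semicircle, (pi l^2 / 2) / (2 pi). As \<open>U\<close> is bounded, the error is at most a constant
  over |J| - |B|.\<close>

lemma gap_transform_asymp: "((\<lambda>J. J * gap_transform J) \<longlongrightarrow> of_real (l\<^sup>2 / 4)) (inf at_infinity (principal {J. Re J > 0}))"
proof -
  have tot: "(LINT s:U|lborel. complex_of_real (gap_density s)) = of_real (l\<^sup>2 / 4)"
  proof -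
    have "(LINT s:U|lborel. gap_density s) = (LINT s:{-l..l}|lborel. sqrt (l\<^sup>2 - s\<^sup>2) / (2 * pi))"
      unfolding gap_density_def
      by (rule set_integral_collapse[of "\<lambda>s. sqrt (l\<^sup>2 - s\<^sup>2) / (2 * pi)"]) measurable
    also have "\<dots> = integral {-l..l} (\<lambda>s. sqrt (l\<^sup>2 - s\<^sup>2) / (2 * pi))"
      by (intro set_borel_integral_eq_integral(2) borel_integrable_atLeastAtMost' continuous_intros) auto
    also have "\<dots> = l\<^sup>2 / 4"
      using has_integral_divide[OF has_integral_Re[OF integral_semicircle[OF l_pos]], of "2 * pi"]
      by (intro integral_unique) (simp add: field_simps)
    finally show ?thesis by (simp only: set_integral_complex_of_real)
  qed
  define C where "C = 2 * l * (l * \<bar>B\<bar>)"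
  have bound: "norm (J * gap_transform J - of_real (l\<^sup>2 / 4)) \<le> C / (norm J - \<bar>B\<bar>)"
    if J: "Re J > 0" "norm J > \<bar>B\<bar>" for J
  proof -
    have J0: "Re J \<noteq> 0" using J by simp
    have nz: "J - \<i> * of_real s \<noteq> 0" for s using J by (auto simp: complex_eq_iff)
    have eq: "J * (of_real (gap_density s) / (J - \<i> * of_real s)) - of_real (gap_density s)
        = of_real (gap_density s) * (\<i> * of_real s) / (J - \<i> * of_real s)" for s
      using nz[of s] by (simp add: field_simps)
    have "set_integrable lborel U (\<lambda>s. complex_of_real (gap_density s))"
      by (rule set_integrable_bounded[of _ l]) (use gap_density_nonneg gap_density_le in auto)
    hence "J * gap_transform J - of_real (l\<^sup>2 / 4)
        = (LINT s:U|lborel. J * (of_real (gap_density s) / (J - \<i> * of_real s)) - of_real (gap_density s))"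
      unfolding tot[symmetric] gap_transform_def using set_integrable_gap_transform[OF J0]
      by (simp add: set_integral_diff del: times_divide_eq_right times_divide_eq_left)
    also have "norm \<dots> \<le> 2 * l * (l * \<bar>B\<bar> / (norm J - \<bar>B\<bar>))"
      unfolding eq
    proof (rule norm_set_integral_le)
      fix s assume "s \<in> U"
      hence s: "\<bar>s\<bar> \<le> \<bar>B\<bar>" using U_bounded by (force simp: abs_le_iff)
      have "norm J - \<bar>B\<bar> \<le> norm (J - \<i> * of_real s)"
        using norm_triangle_ineq2[of J "\<i> * of_real s"] s by (simp add: norm_mult)
      thus "norm (of_real (gap_density s) * (\<i> * of_real s) / (J - \<i> * of_real s)) \<le> l * \<bar>B\<bar> / (norm J - \<bar>B\<bar>)"
        unfolding norm_divide norm_mult using J s gap_density_nonneg gap_density_le l_pos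
        by (intro frac_le mult_mono) auto
    qed (use l_pos J in auto)
    finally show ?thesis by (simp add: C_def)
  qed
  have "((\<lambda>J. J * gap_transform J - of_real (l\<^sup>2 / 4)) \<longlongrightarrow> 0) (inf at_infinity (principal {J. Re J > 0}))"
  proof (rule Lim_null_comparison)
    have "eventually (\<lambda>J::complex. norm J > \<bar>B\<bar>) at_infinity"
      using eventually_at_infinity[of "\<lambda>J::complex. norm J > \<bar>B\<bar>"] by (auto intro!: exI[of _ "\<bar>B\<bar> + 1"])
    thus "eventually (\<lambda>J. norm (J * gap_transform J - of_real (l\<^sup>2 / 4)) \<le> C / (norm J - \<bar>B\<bar>))
        (inf at_infinity (principal {J. Re J > 0}))"
      unfolding eventually_inf_principal by eventually_elim (use bound in auto)
    have "filterlim (\<lambda>J::complex. - \<bar>B\<bar> + norm J) at_top at_infinity"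
      by (intro filterlim_tendsto_add_at_top[OF tendsto_const] filterlim_norm_at_top)
    hence "((\<lambda>J::complex. C / (- \<bar>B\<bar> + norm J)) \<longlongrightarrow> 0) at_infinity"
      by (intro tendsto_divide_0[OF tendsto_const] filterlim_at_top_imp_at_infinity)
    thus "((\<lambda>J::complex. C / (norm J - \<bar>B\<bar>)) \<longlongrightarrow> 0) (inf at_infinity (principal {J. Re J > 0}))"
      by (intro tendsto_mono[OF inf_le1]) simp
  qed
  thus ?thesis by (subst LIM_zero_iff[symmetric])
qed

section \<open>Superharmonicity and continuity of the potential\<close>

definition gap_domain :: "complex set" where
  "gap_domain = {J. Re J \<noteq> 0 \<or> Im J \<in> U}"

lemma holomorphic_on_gap_map:
  "gap_map l holomorphic_on {J. Re J \<noteq> 0 \<or> \<bar>Im J\<bar> < l}"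
  unfolding gap_map_def[abs_def] by (intro holomorphic_intros holomorphic_on_gap_root) auto

text \<open>Around a point of \<open>U\<close> the collapse is the translation by - \<sigma>, so the
  collapsed point is J - i \<sigma> and the one-gap function there is a harmonic majorant. The lower
  bound yields contact on the axis, where its error C |Re J| vanishes, and continuity across
  it.\<close>

lemma gap_potential_near_gap:
  assumes y0: "y0 \<in> U"
  obtains d \<sigma> C where "d > 0"
    "\<And>J. J \<in> ball (\<i> * of_real y0) d \<Longrightarrow> Im J \<in> U"
    "\<And>J. J \<in> ball (\<i> * of_real y0) d \<Longrightarrow> \<bar>Im (J - \<i> * of_real \<sigma>)\<bar> < l"
    "\<And>J. J \<in> ball (\<i> * of_real y0) d \<Longrightarrow> gap_potential J \<le> Re (gap_map l (J - \<i> * of_real \<sigma>))"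
    "\<And>J. J \<in> ball (\<i> * of_real y0) d \<Longrightarrow>
       Re (gap_map l (J - \<i> * of_real \<sigma>)) - C * \<bar>Re J\<bar> \<le> gap_potential J"
proof -
  obtain e where e: "e > 0" "\<And>x. \<bar>x - y0\<bar> < e \<Longrightarrow> x \<in> U"
    using open_U y0 unfolding open_dist dist_real_def by metis
  define \<sigma> where "\<sigma> = y0 - collapse y0"
  have transl: "collapse a - collapse b = a - b" if "\<bar>a - y0\<bar> < e" "\<bar>b - y0\<bar> < e" for a b
    using that
  proof (induction a b rule: linorder_wlog)
    case (le a b)
    hence "{a<..b} \<subseteq> U" using e(2) by (auto simp: abs_less_iff)
    thus ?case using collapse_translation[OF le(1)] by simp
  next
    case (sym a b) thus ?case by (simp add: algebra_simps)
  qed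
  define d where "d = e / 2"
  have Im: "\<bar>Im J - y0\<bar> < d" if "J \<in> ball (\<i> * of_real y0) d" for J
    using that abs_Im_le_cmod[of "\<i> * of_real y0 - J"] by (simp add: dist_norm)
  have point: "collapsed_point J = J - \<i> * of_real \<sigma>" if "J \<in> ball (\<i> * of_real y0) d" for J
    using transl[of "Im J" y0] Im[OF that] e(1)
    by (simp add: collapsed_point_def complex_eq_iff \<sigma>_def d_def)
  have inU: "Im J \<in> U" if "J \<in> ball (\<i> * of_real y0) d" for J
    using e Im[OF that] by (simp add: d_def)
  define C where "C = 2 * l * (l / d\<^sup>2)"
  \<comment> \<open>For s within e of y0 the two kernels coincide. All other s keep collapsed
    distance at least d = e / 2 from Im J, where the kernel is at most |Re J| / d^2.\<close>
  have low: "Re (gap_map l (collapsed_point J)) - C * \<bar>Re J\<bar> \<le> gap_potential J"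
    if J: "J \<in> ball (\<i> * of_real y0) d" "Re J \<noteq> 0" for J
  proof -
    let ?K = "\<lambda>s. gap_density s * Poisson_kernel (Re J) (collapse (Im J) - collapse s)
               - gap_density s * Poisson_kernel (Re J) (Im J - s)"
    have "Re (gap_map l (collapsed_point J)) - gap_potential J = (LINT s:U|lborel. ?K s)"
      using J(2) by (simp add: Re_gap_map_collapsed_point gap_potential_def set_integral_diff
          set_integrable_gap_density_Poisson)
    also have "\<dots> \<le> norm (LINT s:U|lborel. ?K s)" by simp
    also have "\<dots> \<le> 2 * l * (l * (\<bar>Re J\<bar> / d\<^sup>2))"
    proof (rule norm_set_integral_le)
      fix s
      have ge: "?K s \<ge> 0"
        using J(2) collapse_Lipschitz by (auto intro!: mult_left_mono Poisson_kernel_antimono gap_density_nonneg)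
      show "norm (?K s) \<le> l * (\<bar>Re J\<bar> / d\<^sup>2)"
      proof (cases "\<bar>s - y0\<bar> < e")
        case True
        hence k0: "?K s = 0" using transl[of "Im J" s] Im[OF J(1)] e(1) by (simp add: d_def)
        show ?thesis unfolding k0 using l_pos by simp
      next
        case False
        have "\<bar>collapse (Im J) - collapse s\<bar> \<ge> d"
        proof (cases "s > y0")
          case True
          have le: "r \<le> collapse s - collapse (Im J)" if r: "0 < r" "r < d" for r
          proof -
            have "\<bar>Im J + r - y0\<bar> < e" using Im[OF J(1)] r unfolding d_def by linarith
            hence "collapse (Im J + r) - collapse (Im J) = r"
              using transl[of "Im J + r" "Im J"] Im[OF J(1)] e(1) by (simp add: d_def)
            moreover have "collapse (Im J + r) \<le> collapse s"
              using True False r Im[OF J(1)] unfolding d_def by (intro collapse_mono) linarith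
            ultimately show ?thesis by simp
          qed
          have "d \<le> collapse s - collapse (Im J)"
          proof (rule dense_le_bounded[of 0 d])
            show "0 < d" using e(1) by (simp add: d_def)
          qed (rule le)
          thus ?thesis by simp
        next
          case f: False
          have le: "r \<le> collapse (Im J) - collapse s" if r: "0 < r" "r < d" for r
          proof -
            have "\<bar>Im J - r - y0\<bar> < e" using Im[OF J(1)] r unfolding d_def by linarith
            hence "collapse (Im J) - collapse (Im J - r) = r"
              using transl[of "Im J" "Im J - r"] Im[OF J(1)] e(1) by (simp add: d_def)
            moreover have "collapse s \<le> collapse (Im J - r)"
              using f False r Im[OF J(1)] unfolding d_def by (intro collapse_mono) linarith
            ultimately show ?thesis by simp
          qed
          have "d \<le> collapse (Im J) - collapse s"
          proof (rule dense_le_bounded[of 0 d])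
            show "0 < d" using e(1) by (simp add: d_def)
          qed (rule le)
          thus ?thesis by simp
        qed
        hence "Poisson_kernel (Re J) (collapse (Im J) - collapse s) \<le> \<bar>Re J\<bar> / d\<^sup>2"
          by (rule Poisson_kernel_le') (use e(1) in \<open>simp add: d_def\<close>)
        hence "gap_density s * Poisson_kernel (Re J) (collapse (Im J) - collapse s) \<le> l * (\<bar>Re J\<bar> / d\<^sup>2)"
          using l_pos by (intro mult_mono gap_density_le Poisson_kernel_nonneg) auto
        moreover have "gap_density s * Poisson_kernel (Re J) (Im J - s) \<ge> 0"
          by (simp add: gap_density_nonneg Poisson_kernel_nonneg)
        ultimately show ?thesis using ge by simp
      qed
    qed (use l_pos in auto)
    finally show ?thesis by (simp add: C_def algebra_simps)
  qed
  show ?thesis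
  proof (rule that[of d \<sigma> C])
    fix J assume J: "J \<in> ball (\<i> * of_real y0) d"
    show "Im J \<in> U" by (rule inU[OF J])
    show "\<bar>Im (J - \<i> * of_real \<sigma>)\<bar> < l"
      using abs_collapse_less[OF inU[OF J]] unfolding point[OF J, symmetric] by (simp add: collapsed_point_def)
    show "gap_potential J \<le> Re (gap_map l (J - \<i> * of_real \<sigma>))"
      using gap_potential_le[of J] by (simp only: point[OF J])
    show "Re (gap_map l (J - \<i> * of_real \<sigma>)) - C * \<bar>Re J\<bar> \<le> gap_potential J"
      using low[OF J] gap_potential_imaginary[of J] unfolding point[OF J] by (cases "Re J = 0") auto
  qed (use e in \<open>simp add: d_def\<close>)
qed

lemma holomorphic_on_gap_map_shift:
  assumes "\<And>J. J \<in> S \<Longrightarrow> \<bar>Im (J - \<i> * of_real \<sigma>)\<bar> < l"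
  shows "(\<lambda>J. gap_map l (J - \<i> * of_real \<sigma>)) holomorphic_on S"
proof -
  have "gap_map l \<circ> (\<lambda>J. J - \<i> * of_real \<sigma>) holomorphic_on S"
    using assms by (intro holomorphic_on_compose_gen[OF _ holomorphic_on_gap_map] holomorphic_intros) auto
  thus ?thesis by (simp add: o_def)
qed

lemma gap_potential_halfplane:
  assumes "Re J0 \<noteq> 0"
  obtains g where "g holomorphic_on ball J0 \<bar>Re J0\<bar>"
    "\<And>J. J \<in> ball J0 \<bar>Re J0\<bar> \<Longrightarrow> Re J \<noteq> 0 \<and> gap_potential J = Re (g J)"
proof -
  define c where "c = (if Re J0 > 0 then 1 else 0 :: real)"
  have sg: "sgn (Re J) = sgn (Re J0)" "Re J \<noteq> 0" if "J \<in> ball J0 \<bar>Re J0\<bar>" for J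
    using that abs_Re_le_cmod[of "J0 - J"] assms by (auto simp: dist_norm sgn_if)
  show ?thesis
  proof (rule that[of "\<lambda>J. of_real c * J + of_real (sgn (Re J0)) * gap_transform J"])
    show "(\<lambda>J. of_real c * J + of_real (sgn (Re J0)) * gap_transform J) holomorphic_on ball J0 \<bar>Re J0\<bar>"
      using sg by (intro holomorphic_intros holomorphic_on_subset[OF holomorphic_on_gap_transform]) auto
  next
    fix J assume J: "J \<in> ball J0 \<bar>Re J0\<bar>"
    show "Re J \<noteq> 0 \<and> gap_potential J = Re (of_real c * J + of_real (sgn (Re J0)) * gap_transform J)"
      using sg[OF J] assms
      by (auto simp: gap_potential_gap_transform c_def sgn_if split: if_splits)
  qed
qed

text \<open>Over \<open>U\<close> the translated one-gap function touches from above; off the axis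
  the potential is itself the real part of a holomorphic function.\<close>

lemma harmonically_majorized_on_gap_potential:
  "harmonically_majorized_on gap_domain gap_potential"
  unfolding harmonically_majorized_on_def
proof
  fix J0 assume J0: "J0 \<in> gap_domain"
  show "\<exists>d>0. \<exists>g. ball J0 d \<subseteq> gap_domain \<and> g holomorphic_on ball J0 d \<and>
        (\<forall>J\<in>ball J0 d. gap_potential J \<le> Re (g J)) \<and> gap_potential J0 = Re (g J0)"
  proof (cases "Re J0 = 0")
    case True
    hence J0': "J0 = \<i> * of_real (Im J0)" "Im J0 \<in> U"
      using J0 by (auto simp: gap_domain_def complex_eq_iff)
    from gap_potential_near_gap[OF J0'(2)] obtain d \<sigma> C where d: "d > 0"
      "\<And>J. J \<in> ball J0 d \<Longrightarrow> Im J \<in> U"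
      "\<And>J. J \<in> ball J0 d \<Longrightarrow> \<bar>Im (J - \<i> * of_real \<sigma>)\<bar> < l"
      "\<And>J. J \<in> ball J0 d \<Longrightarrow> gap_potential J \<le> Re (gap_map l (J - \<i> * of_real \<sigma>))"
      "\<And>J. J \<in> ball J0 d \<Longrightarrow> Re (gap_map l (J - \<i> * of_real \<sigma>)) - C * \<bar>Re J\<bar> \<le> gap_potential J"
      using J0'(1) by metis
    have "gap_potential J0 = Re (gap_map l (J0 - \<i> * of_real \<sigma>))"
      using d(1) d(4)[of J0] d(5)[of J0] True by simp
    thus ?thesis
      using d holomorphic_on_gap_map_shift[of "ball J0 d" \<sigma>]
      by (intro exI[of _ d] exI[of _ "\<lambda>J. gap_map l (J - \<i> * of_real \<sigma>)"] conjI) (auto simp: gap_domain_def)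
  next
    case False
    then obtain g where "g holomorphic_on ball J0 \<bar>Re J0\<bar>"
      "\<And>J. J \<in> ball J0 \<bar>Re J0\<bar> \<Longrightarrow> Re J \<noteq> 0 \<and> gap_potential J = Re (g J)"
      by (rule gap_potential_halfplane) blast
    thus ?thesis using False
      by (intro exI[of _ "\<bar>Re J0\<bar>"] exI[of _ g]) (auto simp: gap_domain_def)
  qed
qed

lemma continuous_on_gap_potential: "continuous_on gap_domain gap_potential"
proof (intro continuous_at_imp_continuous_on ballI)
  fix J0 assume J0: "J0 \<in> gap_domain"
  show "isCont gap_potential J0"
  proof (cases "Re J0 = 0")
    case True
    hence J0': "J0 = \<i> * of_real (Im J0)" "Im J0 \<in> U"
      using J0 by (auto simp: gap_domain_def complex_eq_iff)
    from gap_potential_near_gap[OF J0'(2)] obtain d \<sigma> C where d: "d > 0"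
      "\<And>J. J \<in> ball J0 d \<Longrightarrow> \<bar>Im (J - \<i> * of_real \<sigma>)\<bar> < l"
      "\<And>J. J \<in> ball J0 d \<Longrightarrow> gap_potential J \<le> Re (gap_map l (J - \<i> * of_real \<sigma>))"
      "\<And>J. J \<in> ball J0 d \<Longrightarrow> Re (gap_map l (J - \<i> * of_real \<sigma>)) - C * \<bar>Re J\<bar> \<le> gap_potential J"
      using J0'(1) by metis
    let ?g = "\<lambda>J. Re (gap_map l (J - \<i> * of_real \<sigma>))"
    have val: "gap_potential J0 = ?g J0"
      using d(1) d(3)[of J0] d(4)[of J0] True by simp
    have "continuous_on (ball J0 d) (\<lambda>J. gap_map l (J - \<i> * of_real \<sigma>))"
      using d holomorphic_on_gap_map_shift[of "ball J0 d" \<sigma>] holomorphic_on_imp_continuous_on by blast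
    hence c: "isCont (\<lambda>J. gap_map l (J - \<i> * of_real \<sigma>)) J0"
      using d(1) by (simp add: continuous_on_eq_continuous_at)
    have up: "(?g \<longlongrightarrow> ?g J0) (at J0)"
      using c unfolding isCont_def by (rule tendsto_Re)
    have "((\<lambda>J. ?g J - C * \<bar>Re J\<bar>) \<longlongrightarrow> ?g J0 - C * \<bar>Re J0\<bar>) (at J0)"
      by (intro tendsto_intros up)
    hence low: "((\<lambda>J. ?g J - C * \<bar>Re J\<bar>) \<longlongrightarrow> ?g J0) (at J0)" using True by simp
    have ev: "eventually (\<lambda>J. J \<in> ball J0 d) (at J0)"
      using d(1) by (intro eventually_at_in_open') auto
    have "(gap_potential \<longlongrightarrow> ?g J0) (at J0)"
      by (rule tendsto_sandwich[OF _ _ low up]) (use ev in \<open>eventually_elim, use d in blast\<close>)+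
    thus ?thesis by (simp add: isCont_def val)
  next
    case False
    then obtain g where g: "g holomorphic_on ball J0 \<bar>Re J0\<bar>"
      "\<And>J. J \<in> ball J0 \<bar>Re J0\<bar> \<Longrightarrow> Re J \<noteq> 0 \<and> gap_potential J = Re (g J)"
      by (rule gap_potential_halfplane) blast
    have "continuous_on (ball J0 \<bar>Re J0\<bar>) (\<lambda>J. Re (g J))"
      by (intro continuous_intros holomorphic_on_imp_continuous_on g(1))
    hence "continuous_on (ball J0 \<bar>Re J0\<bar>) gap_potential"
      by (rule continuous_on_cong[THEN iffD1, rotated 2]) (use g(2) in auto)
    thus ?thesis using False by (simp add: continuous_on_eq_continuous_at)
  qed
qed

section \<open>The estimate of the Schwarzian\<close>

text \<open>Minimum principle for the difference of the two sides. At boundary points other than 1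
  the Poisson kernel tends to 0 and the potential is nonnegative. Near 1 the potential is at least
  Re ((1 + f z) / (1 - f z)) - 1, so after Julia's lemma only a deficit of 1 remains, which a
  logarithmic term outweighs.\<close>

lemma gap_potential_ge_Poisson_kernel:
  assumes holf: "f holomorphic_on ball 0 1" and f: "f ` ball 0 1 \<subseteq> ball 0 1"
    and lim: "((\<lambda>h. (1 - f (1 - of_real h)) / of_real h) \<longlongrightarrow> of_real a) (at_right 0)"
    and a: "a > 0" and K: "(\<lambda>z. twofold_slit_map (f z)) ` ball 0 1 \<subseteq> gap_domain"
    and z: "z \<in> ball 0 1"
  shows "gap_potential (twofold_slit_map (f z)) \<ge> Re ((1 + z) / (1 - z)) / a"
proof (rule field_le_epsilon)
  define b where "b = ln 2 - ln (norm (1 - z))"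
  \<comment> \<open>The correction \<epsilon> log (2 / |1 - z|) is harmonic and nonnegative in the
    disk and infinite at 1. At the end \<epsilon> is made small for the fixed point z.\<close>
  define v where "v = (\<lambda>\<epsilon> z. gap_potential (twofold_slit_map (f z)) +
      Re (of_real \<epsilon> * (Ln 2 - Ln (1 - z)) - (1 + z) / (1 - z) / of_real a))"
  have z1: "1 - z \<noteq> 0" "Re (1 - z) > 0" if "norm z < 1" for z :: complex
  proof -
    show "Re (1 - z) > 0" using that abs_Re_le_cmod[of z] by simp
    thus "1 - z \<noteq> 0" by (metis less_irrefl zero_complex.sel(1))
  qed
  have holK: "(\<lambda>z. twofold_slit_map (f z)) holomorphic_on ball 0 1"
    using holomorphic_on_compose_gen[OF holf holomorphic_on_twofold_slit_map f] by (simp add: o_def)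
  have v_eq: "v \<epsilon> z = gap_potential (twofold_slit_map (f z)) + \<epsilon> * (ln 2 - ln (norm (1 - z)))
      - Re ((1 + z) / (1 - z)) / a" if "norm z < 1" for \<epsilon> z
    using z1[OF that] Ln_of_real[of 2] by (simp add: v_def del: divide_divide_eq_left)
  have v_nonneg: "v \<epsilon> z \<ge> 0" if \<epsilon>: "\<epsilon> > 0" for \<epsilon>
  proof (rule harmonically_majorized_on_nonneg[OF _ _ _ z])
    have "1 - z \<notin> \<real>\<^sub>\<le>\<^sub>0" if "norm z < 1" for z :: complex
      using z1[OF that] unfolding complex_nonpos_Reals_iff by linarith
    hence holh: "(\<lambda>z. of_real \<epsilon> * (Ln 2 - Ln (1 - z)) - (1 + z) / (1 - z) / of_real a) holomorphic_on ball 0 1"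
      using z1 a by (intro holomorphic_intros) auto
    show "harmonically_majorized_on (ball 0 1) (v \<epsilon>)"
      unfolding v_def
      by (rule harmonically_majorized_on_compose_add[OF harmonically_majorized_on_gap_potential _ holK K holh]) simp
    show "continuous_on (ball 0 1) (v \<epsilon>)"
      unfolding v_def using K
      by (intro continuous_on_add continuous_on_Re continuous_on_compose2[OF continuous_on_gap_potential]
            holomorphic_on_imp_continuous_on holK holh) blast
  next
    fix p :: complex and e :: real assume p: "norm p = 1" and e: "e > 0"
    show "eventually (\<lambda>z. v \<epsilon> z > - e) (at p within ball 0 1)"
    proof (cases "p = 1")
      case False
      have "((\<lambda>z. (1 - (norm z)\<^sup>2) / (norm (1 - z))\<^sup>2 / a) \<longlongrightarrow> (1 - (norm p)\<^sup>2) / (norm (1 - p))\<^sup>2 / a) (at p within ball 0 1)"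
        using False a by (intro tendsto_intros) auto
      hence "((\<lambda>z. (1 - (norm z)\<^sup>2) / (norm (1 - z))\<^sup>2 / a) \<longlongrightarrow> 0) (at p within ball 0 1)"
        by (simp add: p)
      hence "eventually (\<lambda>z. (1 - (norm z)\<^sup>2) / (norm (1 - z))\<^sup>2 / a < e) (at p within ball 0 1)"
        using e by (rule order_tendstoD)
      moreover have "eventually (\<lambda>z. z \<in> ball 0 1) (at p within ball 0 1)"
        by (auto simp: eventually_at_filter)
      ultimately show ?thesis
      proof eventually_elim
        case (elim z)
        have n: "norm z < 1" using elim by simp
        have "norm (1 - z) \<le> 2" using norm_triangle_ineq4[of 1 z] n by simp
        hence "ln (norm (1 - z)) \<le> ln 2" using z1(1)[OF n] by (subst ln_le_cancel_iff) auto
        hence "\<epsilon> * (ln 2 - ln (norm (1 - z))) \<ge> 0" using \<epsilon> by simp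
        moreover have "gap_potential (twofold_slit_map (f z)) \<ge> 0"
          using gap_potential_ge[of "twofold_slit_map (f z)"] by linarith
        moreover have "Re ((1 + z) / (1 - z)) = (1 - (norm z)\<^sup>2) / (norm (1 - z))\<^sup>2"
          using z1(1)[OF n] by (intro Re_cayley) auto
        hence "Re ((1 + z) / (1 - z)) / a < e" using elim by simp
        ultimately show ?case unfolding v_eq[OF n] by linarith
      qed
    next
      case True
      \<comment> \<open>The distance from 1 at which \<epsilon> log (2 / |1 - z|) equals 1, the loss
        in \<open>Re_cayley_le_twofold_slit_map\<close>.\<close>
      define d where "d = 2 * exp (- 1 / \<epsilon>)"
      have "eventually (\<lambda>z. z \<in> ball 0 1 \<and> dist z 1 < d) (at 1 within ball 0 1)"
        unfolding eventually_at by (rule exI[of _ d]) (auto simp: d_def dist_commute)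
      thus ?thesis unfolding True
      proof eventually_elim
        case (elim z)
        hence n: "norm z < 1" by simp
        have "norm (1 - z) < d" using elim by (simp add: dist_norm norm_minus_commute)
        hence "ln (norm (1 - z)) < ln d" using z1(1)[OF n] by (subst ln_less_cancel_iff) (auto simp: d_def)
        also have "ln d = ln 2 - 1 / \<epsilon>" by (simp add: d_def ln_mult)
        finally have "\<epsilon> * (1 / \<epsilon>) < \<epsilon> * (ln 2 - ln (norm (1 - z)))" using \<epsilon> by (intro mult_strict_left_mono) auto
        hence "1 < \<epsilon> * (ln 2 - ln (norm (1 - z)))" using \<epsilon> by simp
        moreover have "Re ((1 + f z) / (1 - f z)) - 1 \<le> gap_potential (twofold_slit_map (f z))"
          using Re_cayley_le_twofold_slit_map[of "f z"] gap_potential_ge[of "twofold_slit_map (f z)"] f n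
          by (force simp: image_subset_iff)
        moreover have "Re ((1 + f z) / (1 - f z)) \<ge> Re ((1 + z) / (1 - z)) / a"
          using n by (intro Julia[OF holf f lim a]) simp
        ultimately show ?case using e unfolding v_eq[OF n] by linarith
      qed
    qed
  qed
  fix e :: real assume e: "e > 0"
  define \<epsilon> where "\<epsilon> = e / (\<bar>b\<bar> + 1)"
  have "\<epsilon> > 0" using e by (simp add: \<epsilon>_def)
  have "\<epsilon> * b \<le> \<epsilon> * (\<bar>b\<bar> + 1)" using \<open>\<epsilon> > 0\<close> by (intro mult_left_mono) auto
  also have "\<dots> = e" by (simp add: \<epsilon>_def)
  finally show "Re ((1 + z) / (1 - z)) / a \<le> gap_potential (twofold_slit_map (f z)) + e"
    using v_nonneg[OF \<open>\<epsilon> > 0\<close>] v_eq[of z \<epsilon>] z by (simp add: b_def)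
qed

text \<open>At z = 1 - h the comparison reads Re k + Re T \<ge> 2 / (a h) - 1 / a, with T the value
  of \<open>gap_transform\<close> at k. The expansion of k cancels the right-hand side, and what is
  left is divided by h before h tends to 0.\<close>

lemma Re_Schwarzian_le:
  assumes holf: "f holomorphic_on ball 0 1" and f: "f ` ball 0 1 \<subseteq> ball 0 1"
    and K: "(\<lambda>z. twofold_slit_map (f z)) ` ball 0 1 \<subseteq> gap_domain"
    and exp: "boundary_expansion f (of_real a) a2 a3" and a: "a > 0"
    and a2: "Re (2 * a2 + of_real a * (1 - of_real a)) = 0"
  shows "Re (a3 / of_real a - a2\<^sup>2 / (of_real a)\<^sup>2) \<le> - (a\<^sup>2 / 4) * (1 - l\<^sup>2 / 4)"
proof -
  let ?F = "at_right (0 :: real)"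
  define \<alpha> where "\<alpha> = a2 / complex_of_real a"
  define k where "k h = twofold_slit_map (f (1 - complex_of_real h))" for h
  note lim = radial_expansion_twofold_slit_map[OF exp a, folded \<alpha>_def, folded k_def]
  \<comment> \<open>The normalization in \<open>class_B\<close>: it makes the constant term of Re k
    equal to - 1 / a, the constant term of the Poisson kernel divided by a.\<close>
  have Re\<alpha>: "2 / a * Re \<alpha> = 1 - 1 / a"
    using a2 a by (simp add: \<alpha>_def field_simps power2_eq_square)
  have pos: "eventually (\<lambda>h. (0::real) < h) ?F" by (rule eventually_at_right_less)
  have ball: "eventually (\<lambda>h. 1 - complex_of_real h \<in> ball 0 1) ?F"
    using filterlim_radial_stolz[of 1] by (auto simp: filterlim_at stolz_angle_def elim: eventually_mono)
  have h0: "filterlim (\<lambda>h. complex_of_real h) (at 0) ?F"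
    unfolding filterlim_at using tendsto_of_real[OF tendsto_ident_at[of 0 "{0<..}"], where 'a = complex] pos
    by (auto elim: eventually_mono)
  have kinf: "filterlim k at_infinity ?F"
  proof -
    have "filterlim (\<lambda>h. (of_real h * k h) * inverse (complex_of_real h)) at_infinity ?F"
      by (rule tendsto_mult_filterlim_at_infinity[OF lim(2) _
            filterlim_compose[OF filterlim_inverse_at_infinity h0]]) (use a in simp)
    thus ?thesis
      by (rule filterlim_mono_eventually) (use pos in \<open>auto elim: eventually_mono\<close>)
  qed
  have kpos: "eventually (\<lambda>h. Re (k h) > 0) ?F"
  proof -
    have "((\<lambda>h. Re (of_real h * k h)) \<longlongrightarrow> Re (of_real (2 / a))) ?F" by (intro tendsto_Re lim(2))
    hence "eventually (\<lambda>h. Re (of_real h * k h) > 0) ?F" by (rule order_tendstoD(1)) (use a in simp)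
    thus ?thesis using pos by eventually_elim (auto simp: zero_less_mult_iff)
  qed
  have "filterlim k (inf at_infinity (principal {J. Re J > 0})) ?F"
    using kinf kpos by (simp add: filterlim_inf filterlim_principal)
  from filterlim_compose[OF gap_transform_asymp this]
  have "((\<lambda>h. k h * gap_transform (k h)) \<longlongrightarrow> of_real (l\<^sup>2 / 4)) ?F" .
  \<comment> \<open>T / h, with T the transform at k, is written as (k T) / (h k): the numerator
    tends to the mass l^2 / 4, the denominator to 2 / a.\<close>
  hence "((\<lambda>h. k h * gap_transform (k h) / (of_real h * k h)) \<longlongrightarrow> of_real (l\<^sup>2 / 4) / of_real (2 / a)) ?F"
    using a by (intro tendsto_divide lim(2)) auto
  hence limT: "((\<lambda>h. k h * gap_transform (k h) / (of_real h * k h)) \<longlongrightarrow> of_real (l\<^sup>2 * a / 8)) ?F"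
    by simp
  have "0 \<le> Re (of_real (2 / a) * (\<alpha>\<^sup>2 - a3 / of_real a) - of_real (a / 2) + of_real (l\<^sup>2 * a / 8))"
  proof (rule tendsto_lowerbound[OF tendsto_Re[OF tendsto_add[OF lim(3) limT]]])
    show "eventually (\<lambda>h. 0 \<le> Re ((k h - (of_real (2 / a) * (1 / of_real h + \<alpha>) - 1)) / of_real h
        + k h * gap_transform (k h) / (of_real h * k h))) ?F"
      using pos ball kpos
    proof eventually_elim
      case (elim h)
      have "Re ((1 + (1 - complex_of_real h)) / (1 - (1 - complex_of_real h))) / a \<le> gap_potential (k h)"
        unfolding k_def by (rule gap_potential_ge_Poisson_kernel[OF holf f lim(1) a K elim(2)])
      hence "(2 - h) / h / a \<le> Re (k h) + Re (gap_transform (k h))"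
        using elim by (simp add: gap_potential_gap_transform Re_divide_of_real)
      moreover have "(2 - h) / h / a = 2 / a / h - 1 / a" using elim a by (simp add: field_simps)
      moreover have "Re (k h - (of_real (2 / a) * (1 / of_real h + \<alpha>) - 1)) = Re (k h) - (2 / a / h - 1 / a)"
      proof -
        have "Re (of_real (2 / a) * (1 / of_real h + \<alpha>)) = 2 / a / h + 2 / a * Re \<alpha>"
          by (simp only: Re_complex_of_real times_complex.sel plus_complex.sel Im_complex_of_real)
             (simp add: Re_divide_of_real distrib_left)
        thus ?thesis using Re\<alpha> by simp
      qed
      ultimately have "0 \<le> (Re (k h - (of_real (2 / a) * (1 / of_real h + \<alpha>) - 1)) + Re (gap_transform (k h))) / h"
        using elim by simp
      also have "\<dots> = Re ((k h - (of_real (2 / a) * (1 / of_real h + \<alpha>) - 1)) / of_real h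
        + k h * gap_transform (k h) / (of_real h * k h))"
      proof -
        have "k h \<noteq> 0" using elim by auto
        hence "k h * gap_transform (k h) / (of_real h * k h) = gap_transform (k h) / of_real h" by simp
        thus ?thesis by (simp only: plus_complex.sel Re_divide_of_real add_divide_distrib)
      qed
      finally show ?case .
    qed
  qed simp
  hence "0 \<le> 2 / a * Re (\<alpha>\<^sup>2 - a3 / of_real a) - a / 2 + l\<^sup>2 * a / 8"
    by (simp only: plus_complex.sel minus_complex.sel Re_complex_of_real times_complex.sel Im_complex_of_real)
  hence "0 \<le> a / 2 * (2 / a * Re (\<alpha>\<^sup>2 - a3 / of_real a) - a / 2 + l\<^sup>2 * a / 8)"
    using a by (intro mult_nonneg_nonneg) auto
  also have "\<dots> = Re (\<alpha>\<^sup>2 - a3 / of_real a) - (a\<^sup>2 / 4) * (1 - l\<^sup>2 / 4)"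
    using a by (simp add: field_simps power2_eq_square)
  finally show ?thesis by (simp add: \<alpha>_def power_divide)
qed

end

section \<open>From the length of the image on the imaginary axis to the gaps\<close>

lemma Re_Schwarzian_le_of_imag_axis_measure:
  assumes t: "0 < t" "t < 1"
    and holf: "f holomorphic_on ball 0 1" and f: "f ` ball 0 1 \<subseteq> ball 0 1"
    and exp: "boundary_expansion f (of_real a) a2 a3" and a: "a > 0"
    and a2: "Re (2 * a2 + of_real a * (1 - of_real a)) = 0"
    and meas: "imag_axis_measure (f ` ball 0 1) \<le> ennreal (2 * t)"
  shows "Re (a3 / of_real a - a2\<^sup>2 / (of_real a)\<^sup>2) \<le> - (a\<^sup>2 / 4) * ((1 - t\<^sup>2) / (1 + t\<^sup>2))\<^sup>2"
proof -
  define k where "k = (\<lambda>z. twofold_slit_map (f z))"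
  have holk: "k holomorphic_on ball 0 1"
    using holomorphic_on_compose_gen[OF holf holomorphic_on_twofold_slit_map f] by (simp add: o_def k_def)
  have fb: "norm (f z) < 1" if "norm z < 1" for z using f that by (simp add: image_subset_iff)
  \<comment> \<open>For the open mapping theorem: h k (1 - h) tends to 2 / a, whereas for constant k
    it would tend to 0.\<close>
  have nonconst_k: "\<not> k constant_on ball 0 1"
  proof
    assume "k constant_on ball 0 1"
    then obtain c where c: "\<And>z. z \<in> ball 0 1 \<Longrightarrow> k z = c" by (auto simp: constant_on_def)
    let ?F = "at_right (0 :: real)"
    have ball: "eventually (\<lambda>h. 1 - complex_of_real h \<in> ball 0 1) ?F"
      using filterlim_radial_stolz[of 1] by (auto simp: filterlim_at stolz_angle_def elim: eventually_mono)
    have "((\<lambda>h. of_real h * c) \<longlongrightarrow> of_real (2 / a)) ?F"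
    proof (rule Lim_transform_eventually)
      show "((\<lambda>h. of_real h * k (1 - of_real h)) \<longlongrightarrow> of_real (2 / a)) ?F"
        using radial_expansion_twofold_slit_map(2)[OF exp a] by (simp only: k_def)
      show "eventually (\<lambda>h. of_real h * k (1 - of_real h) = of_real h * c) ?F"
        using ball by eventually_elim (simp only: c)
    qed
    moreover have "((\<lambda>h. of_real h * c) \<longlongrightarrow> of_real 0 * c) ?F" by (intro tendsto_intros)
    ultimately have "complex_of_real (2 / a) = of_real 0 * c"
      by (rule tendsto_unique[rotated]) simp
    thus False using a by simp
  qed
  hence nonconst: "\<not> f constant_on ball 0 1"
    unfolding constant_on_def k_def by metis
  have openf: "open (f ` ball 0 1)" and openk: "open (k ` ball 0 1)"
    using open_mapping_thm[OF holf open_ball connected_ball open_ball order_refl nonconst]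
      open_mapping_thm[OF holk open_ball connected_ball open_ball order_refl nonconst_k] by auto
  have conti: "continuous_on UNIV (\<lambda>y. \<i> * complex_of_real y)" by (intro continuous_intros)
  define V where "V = {y. \<i> * complex_of_real y \<in> f ` ball 0 1}"
  define W where "W = {y. \<i> * complex_of_real y \<in> k ` ball 0 1}"
  have "open V" "open W"
    using open_vimage[OF openf conti] open_vimage[OF openk conti] by (simp_all add: V_def W_def vimage_def)
  hence VW: "V \<in> sets borel" "W \<in> sets borel" by auto
  have V1: "V \<subseteq> {-1<..<1}"
  proof
    fix y assume "y \<in> V"
    then obtain z where z: "norm z < 1" "\<i> * complex_of_real y = f z" by (auto simp: V_def)
    have "norm (\<i> * complex_of_real y) < 1" using fb[OF z(1)] z(2) by simp
    thus "y \<in> {-1<..<1}" by (simp add: norm_mult abs_less_iff)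
  qed
  have W_eq: "W = (\<lambda>y. 4 * y / (1 + y\<^sup>2)) ` V"
  proof (intro equalityI subsetI)
    fix x assume "x \<in> W"
    then obtain z where z: "norm z < 1" "\<i> * complex_of_real x = k z" by (auto simp: W_def)
    have "Re (k z) = 0" using z(2)[symmetric] by simp
    hence "Re (f z) = 0" using fb[OF z(1)] by (simp add: k_def Re_twofold_slit_map_eq_0_iff)
    hence fz: "f z = \<i> * of_real (Im (f z))" by (simp add: complex_eq_iff)
    have "\<i> * complex_of_real x = \<i> * of_real (4 * Im (f z) / (1 + (Im (f z))\<^sup>2))"
      unfolding z(2) k_def by (subst fz) (rule twofold_slit_map_imaginary)
    hence "x = 4 * Im (f z) / (1 + (Im (f z))\<^sup>2)" by (simp only: mult_cancel_left of_real_eq_iff) simp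
    moreover have "Im (f z) \<in> V" using fz z(1) by (auto simp: V_def)
    ultimately show "x \<in> (\<lambda>y. 4 * y / (1 + y\<^sup>2)) ` V" by blast
  next
    fix x assume "x \<in> (\<lambda>y. 4 * y / (1 + y\<^sup>2)) ` V"
    then obtain y z where y: "x = 4 * y / (1 + y\<^sup>2)" "norm z < 1" "\<i> * complex_of_real y = f z" by (auto simp: V_def)
    hence "k z = \<i> * of_real x" using twofold_slit_map_imaginary[of y] by (simp add: k_def)
    thus "x \<in> W" using y(2) by (force simp: W_def)
  qed
  have "emeasure lborel V \<le> ennreal (2 * t)"
    using meas VW(1) by (simp add: imag_axis_measure_def V_def)
  from emeasure_twofold_slit_image_le[OF t VW(1) V1 this VW(2) W_eq]
  have mW: "emeasure lborel W \<le> ennreal (8 * t / (1 + t\<^sup>2))" .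
  \<comment> \<open>Half of the bound on the length of \<open>W\<close>, and the half-gap 2 c of the
    extremal function, c = \<open>slit_scale t\<close>.\<close>
  define l where "l = 4 * t / (1 + t\<^sup>2)"
  have "1 + t\<^sup>2 > 0" by (simp add: add_pos_nonneg)
  hence l: "l > 0" using t by (simp add: l_def)
  define m where "m = measure lborel W"
  have m: "emeasure lborel W = ennreal m" "m \<ge> 0" "m \<le> 2 * l"
  proof -
    have "emeasure lborel W < \<infinity>" using mW by (simp add: le_less_trans)
    thus m: "emeasure lborel W = ennreal m" unfolding m_def by (intro emeasure_eq_ennreal_measure) auto
    show "m \<ge> 0" by (simp add: m_def)
    show "m \<le> 2 * l" using mW l unfolding m l_def by (subst (asm) ennreal_le_iff) auto
  qed
  have W2: "W \<subseteq> {-2<..<2}"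
  proof
    fix x assume "x \<in> W"
    then obtain y where y: "y \<in> V" "x = 4 * y / (1 + y\<^sup>2)" using W_eq by auto
    have "(1 + y)\<^sup>2 > 0" "(1 - y)\<^sup>2 > 0" using y(1) V1 by auto
    hence "-2 * (1 + y\<^sup>2) < 4 * y" "4 * y < 2 * (1 + y\<^sup>2)" by (simp_all add: power2_eq_square algebra_simps)
    moreover have "1 + y\<^sup>2 > 0" by (simp add: add_pos_nonneg)
    ultimately show "x \<in> {-2<..<2}" by (simp add: y field_simps)
  qed
  \<comment> \<open>The potential is built for total length exactly 2 l. The missing length 2 l - m
    is supplied by an interval beyond 2, disjoint from \<open>W\<close>; more gaps only enlarge
    \<open>gap_domain\<close>, so k still maps into it.\<close>
  define U where "U = W \<union> {2<..<2 + (2 * l - m)}"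
  have mU: "emeasure lborel U = ennreal (2 * l)"
  proof -
    have "emeasure lborel (W \<union> {2<..<2 + (2 * l - m)}) = emeasure lborel W + emeasure lborel {2<..<2 + (2 * l - m)}"
      using W2 VW by (intro plus_emeasure[symmetric]) auto
    also have "\<dots> = ennreal (2 * l)" using m by (simp flip: ennreal_plus)
    finally show ?thesis unfolding U_def .
  qed
  have U: "open U" "U \<subseteq> {- (2 + 2 * l)..2 + 2 * l}"
  proof -
    show "open U" using \<open>open W\<close> by (simp add: U_def open_Un)
    show "U \<subseteq> {- (2 + 2 * l)..2 + 2 * l}" using W2 m l unfolding U_def by force
  qed
  have "k ` ball 0 1 \<subseteq> gap_domain U"
  proof
    fix J assume J: "J \<in> k ` ball 0 1"
    show "J \<in> gap_domain U"
    proof (cases "Re J = 0")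
      case True
      hence "J = \<i> * of_real (Im J)" by (simp add: complex_eq_iff)
      hence "Im J \<in> W" using J by (simp add: W_def)
      thus ?thesis unfolding gap_domain_def[OF U l mU] by (simp add: U_def)
    qed (simp add: gap_domain_def[OF U l mU])
  qed
  from Re_Schwarzian_le[OF U l mU holf f this[unfolded k_def] exp a a2]
  have "Re (a3 / of_real a - a2\<^sup>2 / (of_real a)\<^sup>2) \<le> - (a\<^sup>2 / 4) * (1 - l\<^sup>2 / 4)" .
  also have "1 - l\<^sup>2 / 4 = ((1 - t\<^sup>2) / (1 + t\<^sup>2))\<^sup>2"
    using \<open>1 + t\<^sup>2 > 0\<close> by (simp add: l_def power_divide divide_simps) (simp add: power2_eq_square algebra_simps)
  finally show ?thesis .
qed

theorem theorem4p10:
  fixes t :: real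
  assumes "0 < t" and "t < 1"
  shows
    "(\<forall>f \<in> class_B. imag_axis_measure (f ` ball 0 1) \<le> ennreal (2 * t) \<longrightarrow>
        Re (boundary_schwarzian f / (boundary_deriv f)\<^sup>2)
          \<le> - (3 / 2) * ((1 - t\<^sup>2) / (1 + t\<^sup>2))\<^sup>2) \<and>
     (\<forall>z \<in> ball 0 1. \<exists>!w. w \<in> ball 0 1 \<and> slit_equation t z w) \<and>
     slit_map t holomorphic_on ball 0 1 \<and>
     inj_on (slit_map t) (ball 0 1) \<and>
     slit_map t ` ball 0 1 =
       ball 0 1 - (closed_segment (\<i> * of_real t) \<i> \<union> closed_segment (- \<i> * of_real t) (- \<i>)) \<and>
     slit_map t \<in> class_B \<and>
     imag_axis_measure (slit_map t ` ball 0 1) \<le> ennreal (2 * t) \<and>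
     Re (boundary_schwarzian (slit_map t) / (boundary_deriv (slit_map t))\<^sup>2)
       = - (3 / 2) * ((1 - t\<^sup>2) / (1 + t\<^sup>2))\<^sup>2"
proof (intro conjI ballI impI)
  fix f assume f: "f \<in> class_B" and meas: "imag_axis_measure (f ` ball 0 1) \<le> ennreal (2 * t)"
  obtain a :: real and a2 a3 where a: "a > 0" "Re (2 * a2 + of_real a * (1 - of_real a)) = 0"
    and exp: "boundary_expansion f (of_real a) a2 a3"
    and hol: "f holomorphic_on ball 0 1" "f ` ball 0 1 \<subseteq> ball 0 1"
    using f by (auto simp: class_B_def)
  define S where "S = a3 / complex_of_real a - a2\<^sup>2 / (complex_of_real a)\<^sup>2"
  have "Re (boundary_schwarzian f / (boundary_deriv f)\<^sup>2) = Re (6 * S / of_real (a\<^sup>2))"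
    by (simp add: boundary_schwarzian_def boundary_deriv_def boundary_coeffs_eq[OF exp] S_def)
  also have "\<dots> = 6 / a\<^sup>2 * Re S" by (simp only: Re_divide_of_real) simp
  also have "\<dots> \<le> 6 / a\<^sup>2 * (- (a\<^sup>2 / 4) * ((1 - t\<^sup>2) / (1 + t\<^sup>2))\<^sup>2)"
    unfolding S_def
    by (intro mult_left_mono Re_Schwarzian_le_of_imag_axis_measure[OF assms hol exp a meas]) simp
  also have "\<dots> = - (3 / 2) * ((1 - t\<^sup>2) / (1 + t\<^sup>2))\<^sup>2" using a(1) by simp
  finally show "Re (boundary_schwarzian f / (boundary_deriv f)\<^sup>2)
      \<le> - (3 / 2) * ((1 - t\<^sup>2) / (1 + t\<^sup>2))\<^sup>2" .
next
  define c where "c = slit_scale t"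
  \<comment> \<open>The slit equation divides \<open>twofold_slit_map\<close> by a, which is
    therefore the boundary derivative. The other coefficients are a2 and - a2, whence the sixth part
    of the Schwarzian is (1 - a^2) / 4.\<close>
  define a where "a = 1 / c"
  define a2 where "a2 = (a\<^sup>2 - a) / 2"
  have c: "c > 0" using slit_factor[OF assms] by (simp add: c_def)
  have a: "a > 0" using c by (simp add: a_def)
  have exp: "boundary_expansion (slit_map t) (of_real a) (of_real a2) (of_real (- a2))"
  proof -
    have *: "- (a\<^sup>2 - a) / 2 = - a2" by (simp only: a2_def minus_divide_left)
    show ?thesis
      unfolding *[symmetric] unfolding a2_def
    proof (rule boundary_expansion_slit_equation[OF a])
      show "norm (slit_map t z) < 1 \<and> twofold_slit_map z / of_real a = twofold_slit_map (slit_map t z)"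
        if "z \<in> ball 0 1" for z
        using norm_slit_map[OF assms that] twofold_slit_map_slit_map[OF assms that]
        by (simp add: a_def c_def mult.commute)
    qed
  qed
  show "slit_map t \<in> class_B"
    unfolding class_B_def
  proof (intro CollectI conjI exI)
    show "slit_map t ` ball 0 1 \<subseteq> ball 0 1" using norm_slit_map[OF assms] by auto
    show "a > 0" by (rule a)
    show "boundary_expansion (slit_map t) (of_real a) (of_real a2) (of_real (- a2))" by (rule exp)
    show "Re (2 * of_real a2 + of_real a * (1 - of_real a)) = 0"
    proof -
      have "2 * a2 = a\<^sup>2 - a" by (simp add: a2_def)
      thus ?thesis by (simp add: power2_eq_square algebra_simps)
    qed
  qed (rule holomorphic_on_slit_map[OF assms])
  define S where "S = - a2 / a - a2\<^sup>2 / a\<^sup>2"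
  have "boundary_schwarzian (slit_map t) / (boundary_deriv (slit_map t))\<^sup>2 = of_real (6 * S / a\<^sup>2)"
    by (simp add: boundary_schwarzian_def boundary_deriv_def boundary_coeffs_eq[OF exp] S_def)
  hence "Re (boundary_schwarzian (slit_map t) / (boundary_deriv (slit_map t))\<^sup>2) = 6 * S / a\<^sup>2"
    by (simp only: Re_complex_of_real)
  also have "S = (1 - a\<^sup>2) / 4"
    using a by (simp add: S_def a2_def field_simps power2_eq_square)
  also have "6 * ((1 - a\<^sup>2) / 4) / a\<^sup>2 = - (3 / 2) * (1 - c\<^sup>2)"
    using c by (simp add: a_def field_simps)
  also have "1 - c\<^sup>2 = ((1 - t\<^sup>2) / (1 + t\<^sup>2))\<^sup>2"
  proof -
    have "1 + t\<^sup>2 \<noteq> 0" by (simp add: add_nonneg_eq_0_iff)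
    thus ?thesis unfolding c_def slit_scale_def
      by (simp add: power_divide divide_simps) (simp add: power2_eq_square algebra_simps)
  qed
  finally show "Re (boundary_schwarzian (slit_map t) / (boundary_deriv (slit_map t))\<^sup>2)
       = - (3 / 2) * ((1 - t\<^sup>2) / (1 + t\<^sup>2))\<^sup>2" .
next
  have seg: "closed_segment (\<i> * of_real t) \<i> = {w. Re w = 0 \<and> t \<le> Im w \<and> Im w \<le> 1}"
    using closed_segment_imaginary[of t 1] assms by simp
  have seg': "closed_segment (- \<i> * of_real t) (- \<i>) = {w. Re w = 0 \<and> -1 \<le> Im w \<and> Im w \<le> - t}"
    using closed_segment_imaginary[of "-1" "-t"] assms by (simp add: closed_segment_commute)
  show "slit_map t ` ball 0 1 =
       ball 0 1 - (closed_segment (\<i> * of_real t) \<i> \<union> closed_segment (- \<i> * of_real t) (- \<i>))"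
  proof (intro set_eqI)
    fix w
    have "\<bar>Im w\<bar> < 1" if "norm w < 1" using that abs_Im_le_cmod[of w] by simp
    thus "w \<in> slit_map t ` ball 0 1 \<longleftrightarrow>
        w \<in> ball 0 1 - (closed_segment (\<i> * of_real t) \<i> \<union> closed_segment (- \<i> * of_real t) (- \<i>))"
      unfolding slit_map_image_iff[OF assms] seg seg' by (auto simp: abs_less_iff)
  qed
  have "{y. \<i> * complex_of_real y \<in> slit_map t ` ball 0 1} = {-t<..<t}"
    using assms by (auto simp: slit_map_image_iff norm_mult)
  thus "imag_axis_measure (slit_map t ` ball 0 1) \<le> ennreal (2 * t)"
    using assms by (simp add: imag_axis_measure_def)
qed (rule ex1_slit_equation[OF assms] holomorphic_on_slit_map[OF assms] inj_on_slit_map[OF assms] | assumption)+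

end
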